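(* There is an algorithm that, given a tree $T=(V,E)$, a set $V'\subseteq V$ of vertices with $\pi_i(v)=1$ for $v\in V'$ and $\pi_i(v)=0$ for $v\notin V'$, all spread probabilities, edge costs and vertex values equal to 1, and an integer budget $B$, correctly computes a cut system $H\subseteq E$ with $|H|\le B$ that minimizes the risk $\rho(T_H)$ (equivalently, maximizes the number of vertices not reachable in $T_H$ from any vertex of $V'$), together with this optimal number of saved vertices. Its running time is $O(|V|\cdot B^2)$.
   Context: Windy Firebreak Location (optimization version) on an undirected graph: a cut system is a set $H\subseteq E$ of edges, $T_H$ is the graph with these edges removed, its cost is $\sum_{e\in H}\kappa(e)$, and the risk is $\rho(T_H)=\sum_{x\in V}\varphi(x)\left(1-\prod_{t\in U_{x,H}}(1-\pi_i(t))\right)$, where $U_{x,H}$ is the set of vertices in the connected component of $x$ in $T_H$. The goal is to minimize the risk over cut systems of cost at most $B$. With binary ignition probabilities and unit values, a vertex burns (with probability 1) iff its component in $T_H$ contains a vertex of $V'$, and otherwise it is saved. *)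

theory Defs
  imports Complex_Main
begin

section \<open>Finite simple undirected graphs and trees\<close>

text \<open>A graph is a vertex set \<open>V\<close> together with a set \<open>E\<close> of two-element subsets of \<open>V\<close>.\<close>

definition simple_graph :: "'a set \<Rightarrow> 'a set set \<Rightarrow> bool" where
  "simple_graph V E \<longleftrightarrow> finite V \<and> (\<forall>e\<in>E. e \<subseteq> V \<and> card e = 2)"

definition adjacency :: "'a set set \<Rightarrow> ('a \<times> 'a) set" where
  "adjacency E = {(u, v). {u, v} \<in> E}"

definition reachable :: "'a set set \<Rightarrow> 'a \<Rightarrow> 'a \<Rightarrow> bool" where
  "reachable E u v \<longleftrightarrow> (u, v) \<in> (adjacency E)\<^sup>*"

definition component :: "'a set \<Rightarrow> 'a set set \<Rightarrow> 'a \<Rightarrow> 'a set" where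
  "component V E x = {y \<in> V. reachable E x y}"

definition connected_graph :: "'a set \<Rightarrow> 'a set set \<Rightarrow> bool" where
  "connected_graph V E \<longleftrightarrow> V \<noteq> {} \<and> (\<forall>u\<in>V. \<forall>v\<in>V. reachable E u v)"

definition is_cycle :: "'a set set \<Rightarrow> 'a list \<Rightarrow> bool" where
  "is_cycle E p \<longleftrightarrow> 3 \<le> length p \<and> distinct p \<and>
     successively (\<lambda>u v. {u, v} \<in> E) p \<and> {last p, hd p} \<in> E"

definition is_tree :: "'a set \<Rightarrow> 'a set set \<Rightarrow> bool" where
  "is_tree V E \<longleftrightarrow> simple_graph V E \<and> connected_graph V E \<and> (\<nexists>p. is_cycle E p)"

section \<open>Windy Firebreak Location\<close>

definition cut_cost :: "('a set \<Rightarrow> real) \<Rightarrow> 'a set set \<Rightarrow> real" where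
  "cut_cost \<kappa> H = (\<Sum>e\<in>H. \<kappa> e)"

text \<open>
  Spread probabilities are 1 throughout, so a fire burns the whole connected component in which it
  starts; \<open>\<phi>\<close> are the vertex values and \<open>\<pi>\<^sub>i\<close> the (independent) ignition probabilities.
\<close>

definition risk :: "'a set \<Rightarrow> 'a set set \<Rightarrow> ('a \<Rightarrow> real) \<Rightarrow> ('a \<Rightarrow> real) \<Rightarrow> 'a set set \<Rightarrow> real" where
  "risk V E \<phi> \<pi>\<^sub>i H =
     (\<Sum>x\<in>V. \<phi> x * (1 - (\<Prod>t\<in>component V (E - H) x. 1 - \<pi>\<^sub>i t)))"

definition feasible_cut :: "'a set set \<Rightarrow> ('a set \<Rightarrow> real) \<Rightarrow> real \<Rightarrow> 'a set set \<Rightarrow> bool" where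
  "feasible_cut E \<kappa> B H \<longleftrightarrow> H \<subseteq> E \<and> cut_cost \<kappa> H \<le> B"

definition optimal_cut ::
  "'a set \<Rightarrow> 'a set set \<Rightarrow> ('a set \<Rightarrow> real) \<Rightarrow> ('a \<Rightarrow> real) \<Rightarrow> ('a \<Rightarrow> real) \<Rightarrow> real \<Rightarrow> 'a set set \<Rightarrow> bool"
  where
  "optimal_cut V E \<kappa> \<phi> \<pi>\<^sub>i B H \<longleftrightarrow> feasible_cut E \<kappa> B H \<and>
     (\<forall>H'. feasible_cut E \<kappa> B H' \<longrightarrow> risk V E \<phi> \<pi>\<^sub>i H \<le> risk V E \<phi> \<pi>\<^sub>i H')"

definition saved :: "'a set \<Rightarrow> 'a set set \<Rightarrow> 'a set \<Rightarrow> 'a set set \<Rightarrow> 'a set" where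
  "saved V E V' H = {x \<in> V. \<nexists>v. v \<in> V' \<and> reachable (E - H) v x}"

section \<open>Machine model\<close>

text \<open>
  Algorithms are programs of a structured random access machine with uniform cost measure: finitely
  many registers and arrays per program, holding natural numbers, with addition, truncated
  subtraction, comparison and indirect addressing as primitive operations. There is deliberately
  no unit-cost multiplication. Every node of an expression evaluated and every command executed
  is charged one step.
\<close>

type_synonym vname = string

record store =
  reg :: "vname \<Rightarrow> nat"
  arr :: "vname \<Rightarrow> nat \<Rightarrow> nat"

datatype aexp =
    Const nat
  | Reg vname
  | Arr vname aexp
  | Add aexp aexp
  | Sub aexp aexp

datatype bexp =
    Less aexp aexp
  | Equal aexp aexp
  | Neg bexp
  | Conj bexp bexp

datatype com =
    Skip
  | Assign vname aexp
  | Store vname aexp aexp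
  | Seq com com
  | Cond bexp com com
  | While bexp com

fun aval :: "aexp \<Rightarrow> store \<Rightarrow> nat" where
  "aval (Const k) s = k"
| "aval (Reg x) s = reg s x"
| "aval (Arr a e) s = arr s a (aval e s)"
| "aval (Add e f) s = aval e s + aval f s"
| "aval (Sub e f) s = aval e s - aval f s"

fun acost :: "aexp \<Rightarrow> nat" where
  "acost (Const k) = 1"
| "acost (Reg x) = 1"
| "acost (Arr a e) = acost e + 1"
| "acost (Add e f) = acost e + acost f + 1"
| "acost (Sub e f) = acost e + acost f + 1"

fun bval :: "bexp \<Rightarrow> store \<Rightarrow> bool" where
  "bval (Less e f) s \<longleftrightarrow> aval e s < aval f s"
| "bval (Equal e f) s \<longleftrightarrow> aval e s = aval f s"
| "bval (Neg b) s \<longleftrightarrow> \<not> bval b s"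
| "bval (Conj b c) s \<longleftrightarrow> bval b s \<and> bval c s"

fun bcost :: "bexp \<Rightarrow> nat" where
  "bcost (Less e f) = acost e + acost f + 1"
| "bcost (Equal e f) = acost e + acost f + 1"
| "bcost (Neg b) = bcost b + 1"
| "bcost (Conj b c) = bcost b + bcost c + 1"

definition set_reg :: "vname \<Rightarrow> nat \<Rightarrow> store \<Rightarrow> store" where
  "set_reg x k s = s\<lparr>reg := (reg s)(x := k)\<rparr>"

definition set_arr :: "vname \<Rightarrow> nat \<Rightarrow> nat \<Rightarrow> store \<Rightarrow> store" where
  "set_arr a i k s = s\<lparr>arr := (arr s)(a := (arr s a)(i := k))\<rparr>"

text \<open>\<open>exec c s t s'\<close>: started in store \<open>s\<close>, the program \<open>c\<close> halts in store \<open>s'\<close> after \<open>t\<close> steps.\<close>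

inductive exec :: "com \<Rightarrow> store \<Rightarrow> nat \<Rightarrow> store \<Rightarrow> bool" where
  Skip: "exec Skip s 1 s"
| Assign: "exec (Assign x e) s (acost e + 1) (set_reg x (aval e s) s)"
| Store: "exec (Store a i e) s (acost i + acost e + 1) (set_arr a (aval i s) (aval e s) s)"
| Seq: "exec c s t s' \<Longrightarrow> exec d s' u s'' \<Longrightarrow> exec (Seq c d) s (t + u + 1) s''"
| CondTrue: "bval b s \<Longrightarrow> exec c s t s' \<Longrightarrow> exec (Cond b c d) s (bcost b + t + 1) s'"
| CondFalse: "\<not> bval b s \<Longrightarrow> exec d s t s' \<Longrightarrow> exec (Cond b c d) s (bcost b + t + 1) s'"
| WhileFalse: "\<not> bval b s \<Longrightarrow> exec (While b c) s (bcost b + 1) s"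
| WhileTrue: "bval b s \<Longrightarrow> exec c s t s' \<Longrightarrow> exec (While b c) s' u s'' \<Longrightarrow>
    exec (While b c) s (bcost b + t + u + 1) s''"

inductive_cases exec_SkipE: "exec Skip s t s'"
inductive_cases exec_AssignE: "exec (Assign x e) s t s'"
inductive_cases exec_StoreE: "exec (Store a i e) s t s'"
inductive_cases exec_SeqE: "exec (Seq c d) s t s'"
inductive_cases exec_CondE: "exec (Cond b c d) s t s'"
inductive_cases exec_WhileE: "exec (While b c) s t s'"

lemma exec_deterministic:
  "exec c s t s' \<Longrightarrow> exec c s u s'' \<Longrightarrow> u = t \<and> s'' = s'"
proof (induction arbitrary: u s'' rule: exec.induct)
  case (Skip s)
  then show ?case by (rule exec_SkipE) simp
next
  case (Assign x e s)
  then show ?case by (rule exec_AssignE) simp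
next
  case (Store a i e s)
  then show ?case by (rule exec_StoreE) simp
next
  case (Seq c s t s' d v r)
  from Seq.prems show ?case by (rule exec_SeqE) (auto dest!: Seq.IH)
next
  case (CondTrue b s c t s' d)
  from CondTrue.prems show ?case
    by (rule exec_CondE) (use CondTrue.hyps in \<open>auto dest!: CondTrue.IH\<close>)
next
  case (CondFalse b s d t s' c)
  from CondFalse.prems show ?case
    by (rule exec_CondE) (use CondFalse.hyps in \<open>auto dest!: CondFalse.IH\<close>)
next
  case (WhileFalse b s c)
  from WhileFalse.prems show ?case
    by (rule exec_WhileE) (use WhileFalse.hyps in auto)
next
  case (WhileTrue b s c t s' v r)
  from WhileTrue.prems show ?case
    by (rule exec_WhileE) (use WhileTrue.hyps in \<open>auto dest!: WhileTrue.IH\<close>)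
qed

section \<open>Representation of instances and solutions\<close>

text \<open>
  The vertices are \<open>0, \<dots>, n - 1\<close>; the edges are listed without repetition, in arbitrary
  order and with arbitrarily ordered end points.
\<close>

definition uedge :: "nat \<times> nat \<Rightarrow> nat set" where
  "uedge p = {fst p, snd p}"

definition lists_edges :: "(nat \<times> nat) list \<Rightarrow> nat set set \<Rightarrow> bool" where
  "lists_edges es E \<longleftrightarrow> distinct (map uedge es) \<and> set (map uedge es) = E"

definition input_store :: "nat \<Rightarrow> (nat \<times> nat) list \<Rightarrow> nat set \<Rightarrow> nat \<Rightarrow> store" where
  "input_store n es V' B =
     \<lparr>reg = (\<lambda>_. 0)(''n'' := n, ''m'' := length es, ''B'' := B),
      arr = (\<lambda>_ _. 0)
        (''src'' := (\<lambda>i. if i < length es then fst (es ! i) else 0),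
         ''dst'' := (\<lambda>i. if i < length es then snd (es ! i) else 0),
         ''ign'' := (\<lambda>v. if v \<in> V' then 1 else 0))\<rparr>"

text \<open>The computed cut system is given by its characteristic array on the list of edges.\<close>

definition output_cut :: "(nat \<times> nat) list \<Rightarrow> store \<Rightarrow> nat set set" where
  "output_cut es s = {uedge (es ! i) | i. i < length es \<and> arr s ''cut'' i \<noteq> 0}"

definition output_saved :: "store \<Rightarrow> nat" where
  "output_saved s = reg s ''saved''"

end

theory Submission imports Defs begin

text \<open>
  Colour the burning vertices \<open>True\<close> and the saved ones \<open>False\<close>. The edges joining different
  colours lie in the cut, and conversely every colouring that is \<open>True\<close> on \<open>V'\<close> is realised by
  cutting its bichromatic edges. So the task is to minimise the total weight over all colourings
  with at most \<open>B\<close> bichromatic edges, where a burning vertex has weight 1, a saved vertex 0, and a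
  saved vertex of \<open>V'\<close> the prohibitive weight \<open>n + 1\<close>.

  The algorithm repeatedly removes a leaf \<open>u\<close> and merges its cost table, indexed by colour and
  budget, into the table of its neighbour \<open>p\<close> by a (min,+)-convolution over the budget, taking
  \<open>O((B + 1)\<^sup>2)\<close> steps. Every merge preserves the optimum of the remaining instance, and undoing
  the merges in reverse order with the recorded minimisers extends an optimal colouring of the
  last vertex to the whole tree. Leaves are found in linear time from vertex degrees: after
  removing \<open>u\<close>, only \<open>p\<close> can become a new leaf, so it is examined next.
\<close>

section \<open>Weakest preconditions with step counts\<close>

text \<open>The edges arrive unordered and the tree unrooted, so a rooted traversal would call for
  adjacency lists; peeling off leaves needs just two numbers per vertex. The recorded minimisers of
  every merge must survive until the reversal, and the correctness statement of a merge refers to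
  the tables it read. Therefore no table is overwritten: each merge writes to fresh cells, and one
  inductive predicate describes the whole log of merges. It is built up rule by rule during
  elimination and inverted rule by rule during backtracking. Being a tree enters the verification of
  the program through two facts on edge indices: a labelling that is constant along every edge is
  constant, and every nonempty set of edges has a vertex incident with exactly one of them. The
  count \<open>m \<le> n\<close> is used for the running time.\<close>

definition wp :: "com \<Rightarrow> store \<Rightarrow> (nat \<Rightarrow> store \<Rightarrow> bool) \<Rightarrow> bool" where
  "wp c s Q \<longleftrightarrow> (\<exists>t s'. exec c s t s' \<and> Q t s')"

lemma wp_Skip: "wp Skip s Q \<longleftrightarrow> Q 1 s"
  unfolding wp_def using exec.Skip by (auto elim: exec_SkipE)

lemma wp_Assign: "wp (Assign x e) s Q \<longleftrightarrow> Q (acost e + 1) (set_reg x (aval e s) s)"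
  unfolding wp_def using exec.Assign[of x e s] by (auto elim: exec_AssignE)

lemma wp_Store:
  "wp (Store a i e) s Q \<longleftrightarrow> Q (acost i + acost e + 1) (set_arr a (aval i s) (aval e s) s)"
  unfolding wp_def using exec.Store[of a i e s] by (auto elim: exec_StoreE)

lemma wp_Seq: "wp (Seq c d) s Q \<longleftrightarrow> wp c s (\<lambda>t s'. wp d s' (\<lambda>u. Q (t + u + 1)))"
proof
  assume "wp (Seq c d) s Q"
  then show "wp c s (\<lambda>t s'. wp d s' (\<lambda>u. Q (t + u + 1)))"
    unfolding wp_def by (elim exE conjE exec_SeqE) (auto intro!: exI)
next
  assume "wp c s (\<lambda>t s'. wp d s' (\<lambda>u. Q (t + u + 1)))"
  then show "wp (Seq c d) s Q"
    unfolding wp_def using exec.Seq by blast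
qed

lemma wp_Cond:
  "wp (Cond b c d) s Q \<longleftrightarrow>
    (if bval b s then wp c s (\<lambda>t. Q (bcost b + t + 1)) else wp d s (\<lambda>t. Q (bcost b + t + 1)))"
  (is "_ \<longleftrightarrow> ?R")
proof
  assume "wp (Cond b c d) s Q"
  then show ?R
    unfolding wp_def by (elim exE conjE exec_CondE) auto
next
  assume ?R
  then show "wp (Cond b c d) s Q"
    unfolding wp_def using exec.CondTrue[of b s c _ _ d] exec.CondFalse[of b s d _ _ c]
    by (cases "bval b s") (simp_all, blast+)
qed

lemmas wp_simps = wp_Skip wp_Assign wp_Store wp_Seq wp_Cond

section \<open>Frame conditions and the loop rule\<close>

fun written_regs :: "com \<Rightarrow> vname set" where
  "written_regs (Assign x e) = {x}"
| "written_regs (Seq c d) = written_regs c \<union> written_regs d"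
| "written_regs (Cond b c d) = written_regs c \<union> written_regs d"
| "written_regs (While b c) = written_regs c"
| "written_regs _ = {}"

fun written_arrs :: "com \<Rightarrow> vname set" where
  "written_arrs (Store a i e) = {a}"
| "written_arrs (Seq c d) = written_arrs c \<union> written_arrs d"
| "written_arrs (Cond b c d) = written_arrs c \<union> written_arrs d"
| "written_arrs (While b c) = written_arrs c"
| "written_arrs _ = {}"

text \<open>A syntactic over-approximation of the effect of \<open>c\<close>. Handing it out
  together with every postcondition keeps the loop invariants down to what the body actually
  changes.\<close>

definition frame :: "com \<Rightarrow> store \<Rightarrow> store \<Rightarrow> bool" where
  "frame c s s' \<longleftrightarrow> (\<forall>x. x \<notin> written_regs c \<longrightarrow> reg s' x = reg s x) \<and>
     (\<forall>a. a \<notin> written_arrs c \<longrightarrow> arr s' a = arr s a)"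

lemma reg_set_reg [simp]: "reg (set_reg x k s) y = (if y = x then k else reg s y)"
  by (simp add: set_reg_def)

lemma arr_set_reg [simp]: "arr (set_reg x k s) = arr s"
  by (simp add: set_reg_def)

lemma reg_set_arr [simp]: "reg (set_arr a i k s) = reg s"
  by (simp add: set_arr_def)

lemma arr_set_arr [simp]: "arr (set_arr a i k s) b = (if b = a then (arr s a)(i := k) else arr s b)"
  by (simp add: set_arr_def)

lemma exec_frame: "exec c s t s' \<Longrightarrow> frame c s s'"
  by (induction rule: exec.induct) (auto simp: frame_def)

lemma frame_refl: "frame c s s"
  by (simp add: frame_def)

lemma frame_trans: "frame c s s' \<Longrightarrow> frame c s' s'' \<Longrightarrow> frame c s s''"
  by (simp add: frame_def)

lemma wp_conseq:
  assumes "wp c s Q" and "\<And>t s'. Q t s' \<Longrightarrow> frame c s s' \<Longrightarrow> Q' t s'"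
  shows "wp c s Q'"
  using assms exec_frame unfolding wp_def by blast

text \<open>The natural number \<open>\<mu>\<close> drops in every round, so there are at most
  \<open>\<mu> s\<^sub>0\<close> rounds of \<open>K\<close> steps plus the test; the extra 1 in the
  bound pays for the final failing test.\<close>

lemma wp_While:
  assumes init: "I s\<^sub>0"
    and step: "\<And>s. I s \<Longrightarrow> frame c s\<^sub>0 s \<Longrightarrow> bval b s \<Longrightarrow> wp c s (\<lambda>t s'. I s' \<and> \<mu> s' < \<mu> s \<and> t \<le> K)"
    and post: "\<And>t s. I s \<Longrightarrow> frame c s\<^sub>0 s \<Longrightarrow> \<not> bval b s \<Longrightarrow>
      t \<le> (\<mu> s\<^sub>0 + 1) * (K + bcost b + 1) \<Longrightarrow> Q t s"
  shows "wp (While b c) s\<^sub>0 Q"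
proof -
  have "I s \<Longrightarrow> frame c s\<^sub>0 s \<Longrightarrow> \<exists>t s'. exec (While b c) s t s' \<and> I s' \<and> frame c s\<^sub>0 s' \<and>
    \<not> bval b s' \<and> t \<le> (\<mu> s + 1) * (K + bcost b + 1)" for s
  proof (induction "\<mu> s" arbitrary: s rule: less_induct)
    case less
    show ?case
    proof (cases "bval b s")
      case True
      from step[OF less.prems True] obtain t s' where body: "exec c s t s'" "I s'" "\<mu> s' < \<mu> s"
        "t \<le> K"
        unfolding wp_def by blast
      have "frame c s\<^sub>0 s'"
        using less.prems(2) exec_frame[OF body(1)] frame_trans by blast
      from less.hyps[OF body(3,2) this] obtain u s'' where
        rest: "exec (While b c) s' u s''" "I s''" "frame c s\<^sub>0 s''" "\<not> bval b s''"
        "u \<le> (\<mu> s' + 1) * (K + bcost b + 1)" by blast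
      have "(\<mu> s' + 1) * (K + bcost b + 1) \<le> \<mu> s * (K + bcost b + 1)"
        using body(3) by (intro mult_right_mono) auto
      with rest(5) have "u \<le> \<mu> s * (K + bcost b + 1)" by (rule le_trans)
      with body(4) have "bcost b + t + u + 1 \<le> (\<mu> s + 1) * (K + bcost b + 1)"
        by (simp only: add_mult_distrib mult_1)
      then show ?thesis
        using exec.WhileTrue[OF True body(1) rest(1)] rest by blast
    next
      case False
      then show ?thesis
        using exec.WhileFalse[OF False] less.prems by fastforce
    qed
  qed
  from this[OF init frame_refl] show ?thesis
    unfolding wp_def using post by blast
qed

section \<open>Acyclic graphs\<close>

text \<open>The end point \<open>x\<close> of a longest path works: a second edge at
  \<open>x\<close> would either prolong the path or lead back into it and close a cycle.
  Connectedness is not assumed, so the result applies to every subset of the edges of a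
  tree.\<close>

lemma acyclic_leaf:
  assumes fin: "finite V" and graph: "\<forall>e\<in>E. e \<subseteq> V \<and> card e = 2"
    and acyc: "\<nexists>p. is_cycle E p" and ne: "E \<noteq> {}"
  shows "\<exists>x e. {f \<in> E. x \<in> f} = {e}"
proof -
  let ?path = "\<lambda>p. p \<noteq> [] \<and> set p \<subseteq> V \<and> distinct p \<and> successively (\<lambda>u v. {u, v} \<in> E) p"
  have bound: "?path p \<Longrightarrow> length p < card V + 1" for p
    using fin by (metis card_mono distinct_card less_add_one order_le_less_trans)
  obtain a b where ab: "{a, b} \<in> E" "a \<noteq> b" "a \<in> V" "b \<in> V"
    using ne graph by (metis all_not_in_conv card_2_iff insert_subset)
  then have path_ab: "?path [a, b]" by auto
  obtain p where p: "?path p" and max: "\<And>q. ?path q \<Longrightarrow> length q \<le> length p"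
    using ex_has_greatest_nat[of ?path "[a, b]" length "card V + 1"] path_ab bound
    by (metis less_imp_le)
  have "2 \<le> length p" using max[OF path_ab] by simp
  then obtain x y r where p_eq: "p = x # y # r"
    by (metis Suc_le_length_iff numeral_2_eq_2)
  have xy: "{x, y} \<in> E" using p p_eq by simp
  have "f = {x, y}" if f: "f \<in> E" "x \<in> f" for f
  proof (rule ccontr)
    assume neq: "f \<noteq> {x, y}"
    obtain z where z: "f = {x, z}" "z \<noteq> x" "z \<in> V"
    proof -
      obtain a b where "f = {a, b}" "a \<noteq> b" using f graph by (meson card_2_iff)
      then show ?thesis using f graph that[of a] that[of b] by fastforce
    qed
    have "z \<in> set p"
    proof (rule ccontr)
      assume "z \<notin> set p"
      then have "?path (z # p)"
        using p z f unfolding p_eq by (simp add: insert_commute)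
      from max[OF this] show False by simp
    qed
    then have "z \<in> set r" using z neq p_eq by auto
    then obtain r1 r2 where r: "r = r1 @ z # r2" by (meson split_list)
    have split: "p = (x # y # r1 @ [z]) @ r2" using p_eq r by simp
    have "successively (\<lambda>u v. {u, v} \<in> E) (x # y # r1 @ [z])" "distinct (x # y # r1 @ [z])"
      using p unfolding split successively_append_iff distinct_append by blast+
    then have "is_cycle E (x # y # r1 @ [z])"
      using f z unfolding is_cycle_def by (simp add: insert_commute)
    then show False using acyc by blast
  qed
  then have "{f \<in> E. x \<in> f} = {{x, y}}" using xy by blast
  then show ?thesis by blast
qed

lemma acyclic_mono:
  assumes "\<nexists>p. is_cycle E p" "F \<subseteq> E"
  shows "\<nexists>p. is_cycle F p"
proof -
  from assms have "is_cycle E p" if "is_cycle F p" for p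
    using that successively_mono[of "\<lambda>u v. {u, v} \<in> F" p "\<lambda>u v. {u, v} \<in> E"]
    unfolding is_cycle_def by blast
  then show ?thesis using assms(1) by blast
qed

text \<open>Deleting a leaf together with its edge lowers both sides by one.\<close>

lemma acyclic_card_edges:
  assumes "finite V" "\<forall>e\<in>E. e \<subseteq> V \<and> card e = 2" "\<nexists>p. is_cycle E p"
  shows "card E \<le> card V"
  using assms
proof (induction "card E" arbitrary: V E)
  case (Suc k)
  then have "E \<noteq> {}" "finite E" by (auto intro: card_ge_0_finite)
  with acyclic_leaf[OF Suc.prems] obtain x e where xe: "{f \<in> E. x \<in> f} = {e}" by blast
  then have "x \<in> V" "e \<in> E" using Suc.prems by auto
  have "card (E - {e}) \<le> card (V - {x})"
  proof (rule Suc.hyps(1))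
    show "k = card (E - {e})" using Suc.hyps(2) \<open>e \<in> E\<close> \<open>finite E\<close> by simp
    show "\<forall>f\<in>E - {e}. f \<subseteq> V - {x} \<and> card f = 2"
    proof (intro ballI conjI)
      fix f assume "f \<in> E - {e}"
      then have "x \<notin> f" using xe by blast
      then show "f \<subseteq> V - {x}" "card f = 2" using Suc.prems(2) \<open>f \<in> E - {e}\<close> by blast+
    qed
    show "\<nexists>p. is_cycle (E - {e}) p" using acyclic_mono[OF Suc.prems(3)] by blast
  qed (use Suc.prems in auto)
  moreover have "card (E - {e}) = card E - 1" "card (V - {x}) = card V - 1" "card V > 0"
    using \<open>x \<in> V\<close> \<open>e \<in> E\<close> \<open>finite E\<close> Suc.prems by (auto simp: card_gt_0_iff)
  ultimately show ?case by simp
qed simp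

section \<open>Leaf elimination\<close>

text \<open>Edges are indices \<open>i < m\<close> with end points \<open>sr i\<close> and
  \<open>ds i\<close>, matching the input arrays, and \<open>w v c\<close> is the weight of vertex
  \<open>v\<close> in colour \<open>c\<close>. Neither acyclicity nor connectedness is part of the
  setting.\<close>

locale cut_dp =
  fixes n m B :: nat and sr ds :: "nat \<Rightarrow> nat" and w :: "nat \<Rightarrow> bool \<Rightarrow> nat"
  assumes ends: "i < m \<Longrightarrow> sr i < n \<and> ds i < n \<and> sr i \<noteq> ds i"
begin

abbreviation row :: "bool \<Rightarrow> nat" where
  "row c \<equiv> (if c then Suc B else 0)"

definition bich :: "(nat \<Rightarrow> bool) \<Rightarrow> nat set \<Rightarrow> nat" where
  "bich L I = card {i \<in> I. L (sr i) \<noteq> L (ds i)}"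

text \<open>Intended as the least weight of \<open>v\<close> and everything merged into it when
  \<open>v\<close> has colour \<open>c\<close> and this part disposes of \<open>b\<close> units of
  budget.\<close>

definition cost :: "(nat \<Rightarrow> nat) \<Rightarrow> (nat \<Rightarrow> nat) \<Rightarrow> nat \<Rightarrow> bool \<Rightarrow> nat \<Rightarrow> nat" where
  "cost F bs v c b = w v c + F (bs v + row c + b)"

text \<open>One candidate of the (min,+)-convolution: \<open>d\<close> is 1 if the edge from
  \<open>u\<close> to \<open>p\<close> is cut, \<open>j\<close> units go to \<open>u\<close>, and
  the rest stays with \<open>p\<close>. It is used for \<open>d + j \<le> b\<close>, where the
  truncated subtraction is exact.\<close>

definition split_val :: "(nat \<Rightarrow> nat) \<Rightarrow> (nat \<Rightarrow> nat) \<Rightarrow> nat \<Rightarrow> nat \<Rightarrow> bool \<Rightarrow> nat \<Rightarrow> nat \<Rightarrow> nat \<Rightarrow> nat"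
  where
  "split_val F bs u p c b d j =
     F (bs p + row c + (b - (d + j))) + cost F bs u (if d = 0 then c else \<not> c) j"

definition merged :: "(nat \<Rightarrow> nat) \<Rightarrow> (nat \<Rightarrow> nat) \<Rightarrow> (nat \<Rightarrow> nat) \<Rightarrow> (nat \<Rightarrow> nat) \<Rightarrow> nat \<Rightarrow> nat \<Rightarrow> nat \<Rightarrow>
  bool"
  where
  "merged F C D bs u p off \<longleftrightarrow> (\<forall>c b. b \<le> B \<longrightarrow>
     D (off + row c + b) \<le> 1 \<and> D (off + row c + b) + C (off + row c + b) \<le> b \<and>
     F (off + row c + b) = split_val F bs u p c b (D (off + row c + b)) (C (off + row c + b)) \<and>
     (\<forall>d j. d \<le> 1 \<longrightarrow> d + j \<le> b \<longrightarrow> F (off + row c + b) \<le> split_val F bs u p c b d j))"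

text \<open>A row pair takes \<open>2 * Suc B\<close> cells. The shared zero pair comes before those
  of the merges, so \<open>offset k\<close> is the first free cell after \<open>k\<close> merges and
  \<open>offset 0\<close> is also the length of a pair.\<close>

abbreviation offset :: "nat \<Rightarrow> nat" where
  "offset k \<equiv> 2 * Suc B * Suc k"

text \<open>A derivation is the history of \<open>k\<close> merges as stored in the arrays, with
  \<open>R\<close> the remaining vertices, \<open>I\<close> the remaining edges and
  \<open>bs\<close> the current row pairs. Inverting the last rule recovers the previous
  \<open>bs\<close>, so the array \<open>base\<close> need not be restored when
  backtracking.\<close>

inductive elim :: "(vname \<Rightarrow> nat \<Rightarrow> nat) \<Rightarrow> nat \<Rightarrow> nat set \<Rightarrow> nat set \<Rightarrow> (nat \<Rightarrow> nat) \<Rightarrow> bool"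
  for A where
  elim_0: "(\<And>i. i < offset 0 \<Longrightarrow> A ''F'' i = 0) \<Longrightarrow> elim A 0 {..<n} {..<m} (\<lambda>_. 0)"
| elim_Suc: "elim A k R I bs \<Longrightarrow> A ''U'' k = u \<Longrightarrow> A ''P'' k = p \<Longrightarrow> A ''E'' k = e \<Longrightarrow>
    u \<in> R \<Longrightarrow> p \<in> R \<Longrightarrow> u \<noteq> p \<Longrightarrow> e \<in> I \<Longrightarrow> {sr e, ds e} = {u, p} \<Longrightarrow>
    (\<And>i. i \<in> I - {e} \<Longrightarrow> sr i \<noteq> u \<and> ds i \<noteq> u) \<Longrightarrow>
    merged (A ''F'') (A ''C'') (A ''D'') bs u p (offset k) \<Longrightarrow>
    elim A (Suc k) (R - {u}) (I - {e}) (bs(p := offset k))"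

text \<open>The last fact places every current row pair below the first free cell, which separates
  the cells a merge reads from those it writes. The equation \<open>k + card R = n\<close> bounds
  the number of merges.\<close>

lemma elim_facts:
  assumes "elim A k R I bs"
  shows "R \<subseteq> {..<n}" "I \<subseteq> {..<m}" "k + card R = n" "k + card I = m"
    "i \<in> I \<Longrightarrow> sr i \<in> R \<and> ds i \<in> R" "bs v + offset 0 \<le> offset k"
proof -
  from assms have "R \<subseteq> {..<n} \<and> I \<subseteq> {..<m} \<and> k + card R = n \<and> k + card I = m \<and>
     (\<forall>i\<in>I. sr i \<in> R \<and> ds i \<in> R) \<and> (\<forall>v. bs v + offset 0 \<le> offset k)"
  proof induction
    case elim_0
    then show ?case using ends by auto
  next
    case (elim_Suc k R I bs u p e)
    then have fin: "finite R" "finite I" by (auto intro: finite_subset)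
    then have "card R > 0" "card I > 0" using elim_Suc.hyps by (auto simp: card_gt_0_iff)
    then have "Suc k + card (R - {u}) = n" "Suc k + card (I - {e}) = m"
      using elim_Suc fin by auto
    moreover have "(bs(p := offset k)) v + offset 0 \<le> offset (Suc k)" for v
    proof -
      have "bs v + offset 0 \<le> offset k" "offset k + offset 0 = offset (Suc k)"
        using elim_Suc.IH by (blast, simp add: algebra_simps)
      then show ?thesis by (auto simp del: mult_Suc_right)
    qed
    ultimately show ?case using elim_Suc by blast
  qed
  then show "R \<subseteq> {..<n}" "I \<subseteq> {..<m}" "k + card R = n" "k + card I = m"
    "i \<in> I \<Longrightarrow> sr i \<in> R \<and> ds i \<in> R" "bs v + offset 0 \<le> offset k" by blast+
qed

lemma merged_cong:
  assumes "merged F C D bs u p off" and "\<And>v. bs v + offset 0 \<le> off"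
    and "\<And>i. i < off + offset 0 \<Longrightarrow> F' i = F i \<and> C' i = C i \<and> D' i = D i"
  shows "merged F' C' D' bs u p off"
proof -
  have new: "F' (off + row c + b) = F (off + row c + b) \<and>
    C' (off + row c + b) = C (off + row c + b) \<and>
    D' (off + row c + b) = D (off + row c + b)" if "b \<le> B" for c b
    using that by (intro assms(3)) simp
  have old: "F' (bs v + row c + b) = F (bs v + row c + b)" if "b \<le> B" for v c b
    using assms(2)[of v] that by (intro assms(3)[THEN conjunct1]) simp
  have val: "split_val F' bs u p c b d j = split_val F bs u p c b d j" if "b \<le> B"
    "d + j \<le> b" for c b d j
  proof -
    have "b - (d + j) \<le> B" "j \<le> B" using that by auto
    then show ?thesis unfolding split_val_def cost_def by (simp only: old)
  qed
  show ?thesis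
    unfolding merged_def
  proof (intro allI impI)
    fix c b assume b: "b \<le> B"
    let ?q = "off + row c + b"
    have "D ?q \<le> 1" "D ?q + C ?q \<le> b" "F ?q = split_val F bs u p c b (D ?q) (C ?q)"
      "\<forall>d j. d \<le> 1 \<longrightarrow> d + j \<le> b \<longrightarrow> F ?q \<le> split_val F bs u p c b d j"
      using assms(1) b unfolding merged_def by blast+
    then show "D' ?q \<le> 1 \<and> D' ?q + C' ?q \<le> b \<and> F' ?q = split_val F' bs u p c b (D' ?q) (C' ?q) \<and>
      (\<forall>d j. d \<le> 1 \<longrightarrow> d + j \<le> b \<longrightarrow> F' ?q \<le> split_val F' bs u p c b d j)"
      using new[OF b, of c] val[OF b] by presburger
  qed
qed

text \<open>The history depends only on log entries below \<open>k\<close> and table cells below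
  \<open>offset k\<close>, so it survives the writes of the next merge.\<close>

lemma elim_cong:
  assumes "elim A k R I bs"
    and "\<And>i. i < k \<Longrightarrow> A' ''U'' i = A ''U'' i \<and> A' ''P'' i = A ''P'' i \<and> A' ''E'' i = A ''E'' i"
    and "\<And>i. i < offset k \<Longrightarrow> A' ''F'' i = A ''F'' i \<and> A' ''C'' i = A ''C'' i \<and>
      A' ''D'' i = A ''D'' i"
  shows "elim A' k R I bs"
  using assms
proof (induction)
  case elim_0
  then show ?case by (intro elim.elim_0) simp
next
  case (elim_Suc k R I bs u p e)
  have off: "offset k + offset 0 = offset (Suc k)" by (simp add: algebra_simps)
  show ?case
  proof (rule elim.elim_Suc)
    show "elim A' k R I bs" using elim_Suc off by (intro elim_Suc.IH) auto
    show "merged (A' ''F'') (A' ''C'') (A' ''D'') bs u p (offset k)"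
      using elim_Suc.hyps(11)
    proof (rule merged_cong)
      show "bs v + offset 0 \<le> offset k" for v
        using elim_facts(6)[OF elim_Suc.hyps(1)] .
      show "i < offset k + offset 0 \<Longrightarrow> A' ''F'' i = A ''F'' i \<and> A' ''C'' i = A ''C'' i \<and>
        A' ''D'' i = A ''D'' i" for i
        using elim_Suc.prems(2)[of i] unfolding off .
    qed
  qed (use elim_Suc in auto)
qed

text \<open>Connectedness is phrased through labellings, so no paths have to be followed: a
  labelling of the graph without \<open>u\<close> extends to \<open>u\<close> by copying the colour
  of \<open>p\<close>.\<close>

lemma elim_connected:
  assumes "elim A k R I bs"
    and "\<And>L :: nat \<Rightarrow> bool. \<forall>i<m. L (sr i) = L (ds i) \<Longrightarrow> \<forall>a<n. \<forall>b<n. L a = L b"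
    and "\<forall>i\<in>I. L (sr i) = L (ds i)" and "a \<in> R" "b \<in> R"
  shows "L a = (L b :: bool)"
  using assms
proof (induction arbitrary: L a b)
  case elim_0
  then show ?case by (metis lessThan_iff)
next
  case (elim_Suc k R I bs u p e)
  have "(L(u := L p)) a = (L(u := L p)) b"
  proof (rule elim_Suc.IH)
    show "\<forall>i\<in>I. (L(u := L p)) (sr i) = (L(u := L p)) (ds i)"
    proof
      fix i assume "i \<in> I"
      show "(L(u := L p)) (sr i) = (L(u := L p)) (ds i)"
      proof (cases "i = e")
        case True
        then show ?thesis using \<open>{sr e, ds e} = {u, p}\<close> by (auto simp: doubleton_eq_iff)
      next
        case False
        then show ?thesis using elim_Suc.hyps(10)[of i] elim_Suc.prems(2) \<open>i \<in> I\<close> by auto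
      qed
    qed
  qed (use elim_Suc.prems in auto)
  then show ?case using elim_Suc.prems by auto
qed

section \<open>Budgeted colourings across a merge\<close>

lemma bich_remove:
  assumes "finite I" "e \<in> I"
  shows "bich L I = bich L (I - {e}) + of_bool (L (sr e) \<noteq> L (ds e))"
proof (cases "L (sr e) \<noteq> L (ds e)")
  case True
  then have "{i \<in> I. L (sr i) \<noteq> L (ds i)} = insert e {i \<in> I - {e}. L (sr i) \<noteq> L (ds i)}"
    using assms by auto
  then show ?thesis using True assms unfolding bich_def by simp
next
  case False
  then have "{i \<in> I. L (sr i) \<noteq> L (ds i)} = {i \<in> I - {e}. L (sr i) \<noteq> L (ds i)}" by auto
  then show ?thesis using False unfolding bich_def by simp
qed

lemma sum_remove2:
  fixes f :: "nat \<Rightarrow> nat"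
  assumes "finite R" "u \<in> R" "p \<in> R" "u \<noteq> p"
  shows "sum f R = f u + f p + sum f (R - {u, p})" "sum f (R - {u}) = f p + sum f (R - {u, p})"
proof -
  have "R - {u} - {p} = R - {u, p}" by auto
  then show "sum f (R - {u}) = f p + sum f (R - {u, p})"
    using sum.remove[of "R - {u}" p f] assms by simp
  then show "sum f R = f u + f p + sum f (R - {u, p})"
    using sum.remove[of R u f] assms by simp
qed

text \<open>
  Every unit of the budget is either spent on a bichromatic edge or parked at a vertex. Since the
  sum is exactly \<open>B\<close>, the last remaining vertex carries \<open>B\<close>, and no monotonicity of the tables in
  the budget is needed.
\<close>

definition fits :: "(nat \<Rightarrow> nat) \<Rightarrow> nat set \<Rightarrow> nat set \<Rightarrow> (nat \<Rightarrow> nat) \<Rightarrow> (nat \<Rightarrow> bool) \<Rightarrow> (nat \<Rightarrow> nat) \<Rightarrow>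
  nat \<Rightarrow> bool"
  where
  "fits F R I bs L \<beta> X \<longleftrightarrow> (\<Sum>v\<in>R. \<beta> v) + bich L I = B \<and> (\<Sum>v\<in>R. cost F bs v (L v) (\<beta> v)) = X"

text \<open>A fixed colouring can be tracked through all merges. The shares of \<open>u\<close> and
  \<open>p\<close> and the price of their edge are pooled at \<open>p\<close>; the old distribution
  is one of the candidates of the minimum, so the value never grows.\<close>

lemma elim_lower_bound:
  assumes "elim A k R I bs" and "bich L {..<m} \<le> B" and "0 < n"
  shows "\<exists>\<beta> X. fits (A ''F'') R I bs L \<beta> X \<and> X \<le> (\<Sum>v<n. w v (L v))"
  using assms
proof induction
  case elim_0
  \<comment> \<open>The unspent budget has to be parked somewhere so that the sum is exactly
    \<open>B\<close>; vertex 0 is an arbitrary choice.\<close>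
  define \<beta> where "\<beta> v = (if v = 0 then B - bich L {..<m} else 0)" for v :: nat
  have "(\<Sum>v<n. \<beta> v) = B - bich L {..<m}"
    using \<open>0 < n\<close> unfolding \<beta>_def by (simp add: sum.delta)
  moreover have "cost (A ''F'') (\<lambda>_. 0) v (L v) (\<beta> v) = w v (L v)" for v
  proof -
    have "\<beta> v \<le> B" unfolding \<beta>_def by simp
    then show ?thesis unfolding cost_def using elim_0(1) by simp
  qed
  ultimately show ?case using elim_0 unfolding fits_def by (intro exI[of _ \<beta>]) auto
next
  case (elim_Suc k R I bs u p e)
  note facts = elim_facts[OF elim_Suc.hyps(1)]
  have fin: "finite R" "finite I" using facts by (auto intro: finite_subset)
  let ?F = "A ''F''"
  let ?bs = "bs(p := offset k)"
  obtain \<beta> X where \<beta>: "fits ?F R I bs L \<beta> X" "X \<le> (\<Sum>v<n. w v (L v))"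
    using elim_Suc by blast
  note split = sum_remove2[OF fin(1) \<open>u \<in> R\<close> \<open>p \<in> R\<close> \<open>u \<noteq> p\<close>]
  define d :: nat where "d = of_bool (L u \<noteq> L p)"
  define b where "b = \<beta> p + (d + \<beta> u)"
  have "of_bool (L (sr e) \<noteq> L (ds e)) = d"
    using \<open>{sr e, ds e} = {u, p}\<close> unfolding d_def by (auto simp: doubleton_eq_iff)
  then have bich: "bich L I = bich L (I - {e}) + d"
    using bich_remove[OF fin(2) \<open>e \<in> I\<close>, of L] by simp
  have rest: "(\<Sum>v\<in>R - {u, p}. (\<beta>(p := b)) v) = (\<Sum>v\<in>R - {u, p}. \<beta> v)"
    "(\<Sum>v\<in>R - {u, p}. cost ?F ?bs v (L v) ((\<beta>(p := b)) v)) =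
      (\<Sum>v\<in>R - {u, p}. cost ?F bs v (L v) (\<beta> v))"
    by (rule sum.cong; simp add: cost_def)+
  have budget: "(\<Sum>v\<in>R - {u}. (\<beta>(p := b)) v) + bich L (I - {e}) = B"
    using \<beta>(1) unfolding fits_def split bich rest b_def by simp
  then have "b \<le> B" unfolding split by simp
  moreover have "d \<le> 1" "d + \<beta> u \<le> b" unfolding d_def b_def by auto
  ultimately have "?F (offset k + row (L p) + b) \<le> split_val ?F bs u p (L p) b d (\<beta> u)"
    using elim_Suc.hyps(11)[unfolded merged_def, rule_format, of b "L p"] by blast
  moreover have "(if d = 0 then L p else \<not> L p) = L u" unfolding d_def by auto
  ultimately have "cost ?F ?bs p (L p) b \<le> cost ?F bs u (L u) (\<beta> u) + cost ?F bs p (L p) (\<beta> p)"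
    unfolding split_val_def cost_def b_def by simp
  then have "(\<Sum>v\<in>R - {u}. cost ?F ?bs v (L v) ((\<beta>(p := b)) v)) \<le> X"
    using \<beta>(1) unfolding fits_def split rest by simp
  then have "(\<Sum>v\<in>R - {u}. cost ?F ?bs v (L v) ((\<beta>(p := b)) v)) \<le> (\<Sum>v<n. w v (L v))"
    using \<beta>(2) by (rule le_trans)
  with budget show ?case unfolding fits_def by blast
qed

text \<open>The converse direction, with the value \<open>X\<close> kept exactly: the table entry
  equals the candidate recorded in \<open>D\<close> and \<open>C\<close>, so splitting the share of
  \<open>p\<close> accordingly reproduces it. With two colours, \<open>D\<close> determines the
  colour of \<open>u\<close>.\<close>

lemma fits_extend:
  assumes "elim A k R I bs" "u \<in> R" "p \<in> R" "u \<noteq> p" "e \<in> I" "{sr e, ds e} = {u, p}"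
    and other: "\<And>i. i \<in> I - {e} \<Longrightarrow> sr i \<noteq> u \<and> ds i \<noteq> u"
    and merged: "merged (A ''F'') (A ''C'') (A ''D'') bs u p (offset k)"
    and fits: "fits (A ''F'') (R - {u}) (I - {e}) (bs(p := offset k)) L \<beta> X"
    and q: "q = offset k + row (L p) + \<beta> p"
    and L': "L' = L(u := (if A ''D'' q = 0 then L p else \<not> L p))"
    and \<beta>': "\<beta>' = \<beta>(u := A ''C'' q, p := \<beta> p - (A ''D'' q + A ''C'' q))"
  shows "fits (A ''F'') R I bs L' \<beta>' X"
proof -
  let ?F = "A ''F''"
  let ?bs = "bs(p := offset k)"
  let ?d = "A ''D'' q" and ?j = "A ''C'' q"
  note facts = elim_facts[OF assms(1)]
  have fin: "finite R" "finite I" using facts by (auto intro: finite_subset)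
  note split = sum_remove2[OF fin(1) \<open>u \<in> R\<close> \<open>p \<in> R\<close> \<open>u \<noteq> p\<close>]
  have "\<beta> p \<le> B" using fits unfolding fits_def split by simp
  then have q_props: "?d \<le> 1" "?d + ?j \<le> \<beta> p" "?F q = split_val ?F bs u p (L p) (\<beta> p) ?d ?j"
    using merged[unfolded merged_def, rule_format, of "\<beta> p" "L p", folded q] by blast+
  have "of_bool (L' (sr e) \<noteq> L' (ds e)) = ?d"
    using \<open>{sr e, ds e} = {u, p}\<close> \<open>u \<noteq> p\<close> q_props(1) unfolding L' by (auto simp: doubleton_eq_iff)
  moreover have "bich L' (I - {e}) = bich L (I - {e})"
    unfolding bich_def L' using other by (intro arg_cong[where f = card]) auto
  ultimately have bich: "bich L' I = bich L (I - {e}) + ?d"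
    using bich_remove[OF fin(2) \<open>e \<in> I\<close>, of L'] by simp
  have rest: "(\<Sum>v\<in>R - {u, p}. \<beta>' v) = (\<Sum>v\<in>R - {u, p}. \<beta> v)"
    "(\<Sum>v\<in>R - {u, p}. cost ?F bs v (L' v) (\<beta>' v)) = (\<Sum>v\<in>R - {u, p}. cost ?F ?bs v (L v) (\<beta> v))"
    by (rule sum.cong; simp add: cost_def L' \<beta>')+
  have up: "\<beta>' u = ?j" "\<beta>' p = \<beta> p - (?d + ?j)" "L' p = L p"
    "L' u = (if ?d = 0 then L p else \<not> L p)"
    using \<open>u \<noteq> p\<close> unfolding L' \<beta>' by auto
  have "(\<Sum>v\<in>R. \<beta>' v) + bich L' I = B"
    using fits q_props(2) unfolding fits_def split bich rest up by simp
  moreover have "cost ?F bs u (L' u) (\<beta>' u) + cost ?F bs p (L' p) (\<beta>' p) = cost ?F ?bs p (L p)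
    (\<beta> p)"
    using q_props(3) unfolding up split_val_def cost_def q by simp
  then have "(\<Sum>v\<in>R. cost ?F bs v (L' v) (\<beta>' v)) = X"
    using fits unfolding fits_def split rest by simp
  ultimately show ?thesis unfolding fits_def by blast
qed

end

section \<open>The program\<close>

text \<open>
  Rows of the tables are addressed by offsets, so that no multiplication is needed. Array \<open>base\<close>
  holds the offset of the current row pair of a vertex in \<open>F\<close> (label \<open>False\<close> first, label \<open>True\<close>
  at distance \<open>W = B + 1\<close>); the vertex weights are kept out of \<open>F\<close>, so the initial rows of all
  vertices are zero and share offset 0. Each elimination writes a fresh row pair at \<open>off\<close>,
  recording in \<open>C\<close> the budget passed to the leaf and in \<open>D\<close> whether its edge is cut. Array \<open>T\<close>
  holds the sum of the indices of the remaining edges at a vertex, which for a leaf is the index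
  of its only edge.
\<close>

notation Seq (infixr ";;" 60)

definition candidate :: "aexp \<Rightarrow> nat \<Rightarrow> com" where
  "candidate e d =
     Assign ''t'' e ;;
     Cond (Less (Reg ''t'') (Arr ''F'' (Reg ''q'')))
       (Store ''F'' (Reg ''q'') (Reg ''t'') ;;
        Store ''C'' (Reg ''q'') (Reg ''j'') ;;
        Store ''D'' (Reg ''q'') (Const d))
       Skip"

text \<open>Register \<open>a\<close> points to the row of \<open>p\<close> for the colour treated,
  \<open>f\<close> and \<open>g\<close> to the rows of \<open>u\<close> for the same and for the
  opposite colour; \<open>x\<close> and \<open>y\<close> are the weights of \<open>u\<close> in
  these two colours. A cut costs one unit, hence the guard \<open>j < b\<close> on the second
  candidate.\<close>

definition split_loop :: com where
  "split_loop =
     While (Less (Reg ''j'') (Add (Reg ''b'') (Const 1)))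
       (candidate (Add (Arr ''F'' (Add (Reg ''a'') (Sub (Reg ''b'') (Reg ''j''))))
                       (Add (Arr ''F'' (Add (Reg ''f'') (Reg ''j''))) (Reg ''x''))) 0 ;;
        Cond (Less (Reg ''j'') (Reg ''b''))
          (candidate (Add (Arr ''F'' (Add (Reg ''a'') (Sub (Reg ''b'') (Add (Const 1)
            (Reg ''j'')))))
                          (Add (Arr ''F'' (Add (Reg ''g'') (Reg ''j''))) (Reg ''y''))) 1)
          Skip ;;
        Assign ''j'' (Add (Reg ''j'') (Const 1)))"

text \<open>A cell starts with the candidate \<open>d = 0\<close>, \<open>j = 0\<close>, which fits
  every budget, so no infinite value has to be represented.\<close>

definition row_loop :: com where
  "row_loop =
     Assign ''b'' (Const 0) ;;
     While (Less (Reg ''b'') (Reg ''W''))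
       (Store ''F'' (Reg ''q'') (Add (Arr ''F'' (Add (Reg ''a'') (Reg ''b'')))
                                     (Add (Arr ''F'' (Reg ''f'')) (Reg ''x''))) ;;
        Store ''C'' (Reg ''q'') (Const 0) ;;
        Store ''D'' (Reg ''q'') (Const 0) ;;
        Assign ''j'' (Const 0) ;;
        split_loop ;;
        Assign ''q'' (Add (Reg ''q'') (Const 1)) ;;
        Assign ''b'' (Add (Reg ''b'') (Const 1)))"

section \<open>Verification of the convolution over the budget\<close>

definition cand_val :: "(nat \<Rightarrow> nat) \<Rightarrow> nat \<Rightarrow> nat \<Rightarrow> nat \<Rightarrow> nat \<Rightarrow> nat \<Rightarrow> nat \<Rightarrow> nat \<Rightarrow> nat \<Rightarrow> nat" where
  "cand_val F a f g x y b d j = F (a + (b - (d + j))) + (if d =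
    0 then F (f + j) + x else F (g + j) + y)"

definition best :: "store \<Rightarrow> (nat \<Rightarrow> nat \<Rightarrow> nat) \<Rightarrow> nat \<Rightarrow> nat \<Rightarrow> store \<Rightarrow> (nat \<times> nat) set \<Rightarrow> bool" where
  "best s\<^sub>0 val b q s S \<longleftrightarrow>
     (\<forall>i. i \<noteq> q \<longrightarrow> arr s ''F'' i = arr s\<^sub>0 ''F'' i \<and> arr s ''C'' i = arr s\<^sub>0 ''C'' i \<and>
       arr s ''D'' i = arr s\<^sub>0 ''D'' i) \<and>
     arr s ''D'' q \<le> 1 \<and> arr s ''D'' q + arr s ''C'' q \<le> b \<and>
     arr s ''F'' q = val (arr s ''D'' q) (arr s ''C'' q) \<and>
     (\<forall>(d, j)\<in>S. arr s ''F'' q \<le> val d j)"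

lemma best_set_reg [simp]: "best s\<^sub>0 val b q (set_reg x k s) S = best s\<^sub>0 val b q s S"
  by (simp add: best_def)

lemma wp_candidate:
  assumes "best s\<^sub>0 val b q s S" "aval e s = val d (reg s ''j'')" "d \<le> 1" "d + reg s ''j'' \<le> b"
    "reg s ''q'' = q"
  shows "wp (candidate e d) s (\<lambda>t s'. t \<le> acost e + 20 \<and>
    best s\<^sub>0 val b q s' (insert (d, reg s ''j'') S))"
  using assms unfolding candidate_def best_def by (simp add: wp_simps) fastforce

lemma written_candidate: "written_regs (candidate e d) = {''t''}"
  "written_arrs (candidate e d) = {''F'', ''C'', ''D''}"
  by (auto simp: candidate_def)

text \<open>All rows read lie below \<open>q\<close> and only cell \<open>q\<close> is written. The
  candidate values can therefore be taken from the initial table, and \<open>best\<close> with the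
  set of pairs tried so far is invariant.\<close>

lemma wp_split_loop:
  assumes regs: "reg s\<^sub>0 ''a'' = a" "reg s\<^sub>0 ''f'' = f" "reg s\<^sub>0 ''g'' = g" "reg s\<^sub>0 ''x'' = x"
    "reg s\<^sub>0 ''y'' = y"
      "reg s\<^sub>0 ''b'' = b" "reg s\<^sub>0 ''q'' = q" "reg s\<^sub>0 ''j'' = 0"
    and bounds: "a + b < q" "f + b < q" "g + b < q"
    and val: "val = cand_val (arr s\<^sub>0 ''F'') a f g x y b"
    and init: "best s\<^sub>0 val b q s\<^sub>0 {}"
  shows "wp split_loop s\<^sub>0 (\<lambda>t s. t \<le> (b + 2) * 100 \<and> best s\<^sub>0 val b q s {(d, j). d \<le> 1 \<and>
    d + j \<le> b})"
  unfolding split_loop_def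
proof (rule wp_While[where I = "\<lambda>s. reg s ''j'' \<le> b + 1 \<and> best s\<^sub>0 val b q s {(d, j). d \<le> 1 \<and>
  d + j \<le> b \<and> j < reg s ''j''}"
      and \<mu> = "\<lambda>s. b + 1 - reg s ''j''" and K = 90], goal_cases)
  case 1
  show ?case using init regs by simp
next
  case (2 s)
  let ?j = "reg s ''j''"
  have regs_s: "reg s ''a'' = a" "reg s ''f'' = f" "reg s ''g'' = g" "reg s ''x'' = x"
    "reg s ''y'' = y"
      "reg s ''b'' = b" "reg s ''q'' = q"
    using 2(2) regs by (simp_all add: frame_def written_candidate)
  have jb: "?j \<le> b" using 2(3) regs_s by simp
  have old: "arr s' ''F'' i = arr s\<^sub>0 ''F'' i" if "best s\<^sub>0 val b q s' S" "i < q" for s' S i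
    using that unfolding best_def by simp
  let ?S = "{(d, j). d \<le> 1 \<and> d + j \<le> b \<and> j < ?j}"
  have inv: "best s\<^sub>0 val b q s ?S" using 2(1) by simp
  show ?case
    unfolding wp_Seq
  proof (rule wp_conseq, rule wp_candidate[OF inv], goal_cases)
    case 1
    show ?case using jb bounds by (simp add: regs_s old[OF inv] val cand_val_def)
  next
    case (5 t s1)
    then have inv1: "best s\<^sub>0 val b q s1 (insert (0, ?j) ?S)" and t: "t \<le> 35" by auto
    have regs1: "reg s1 ''a'' = a" "reg s1 ''f'' = f" "reg s1 ''g'' = g" "reg s1 ''x'' = x"
      "reg s1 ''y'' = y"
      "reg s1 ''b'' = b" "reg s1 ''q'' = q" "reg s1 ''j'' = ?j"
      using 5(2) regs_s by (simp_all add: frame_def written_candidate)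
    show ?case
    proof (cases "?j < b")
      case True
      have set: "insert (1, ?j) (insert (0, ?j) ?S) = {(d, j). d \<le> 1 \<and> d + j \<le> b \<and> j < Suc ?j}"
        using True by auto
      show ?thesis
        unfolding wp_Cond bval.simps aval.simps regs1 if_P[OF True]
      proof (rule wp_conseq, rule wp_candidate[OF inv1], goal_cases)
        case 1
        show ?case using True bounds by (simp add: regs1 old[OF inv1] val cand_val_def)
      next
        case (5 u s2)
        have "reg s2 ''j'' = ?j" using 5(2) regs1 by (simp add: frame_def written_candidate)
        moreover have "best s\<^sub>0 val b q (set_reg ''j'' (Suc ?j) s2) {(d, j). d \<le> 1 \<and> d + j \<le> b \<and>
          j < Suc ?j}"
          using 5(1) unfolding regs1 set by simp
        ultimately show ?case
          using t 5(1) True by (simp add: wp_simps)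
      qed (use True regs1 in auto)
    next
      case False
      have set: "insert (0, ?j) ?S = {(d, j). d \<le> 1 \<and> d + j \<le> b \<and> j < Suc ?j}"
        using False jb by auto
      have "best s\<^sub>0 val b q (set_reg ''j'' (Suc ?j) s1) {(d, j). d \<le> 1 \<and> d + j \<le> b \<and> j < Suc ?j}"
        using inv1 unfolding set by simp
      then show ?thesis
        using t False jb by (simp add: wp_simps regs1)
    qed
  qed (use jb regs_s in auto)
next
  case (3 t s)
  have "reg s ''b'' = b"
    using 3(2) regs by (simp_all add: frame_def written_candidate)
  then have "{(d, j). d \<le> 1 \<and> d + j \<le> b \<and> j < reg s ''j''} = {(d, j). d \<le> 1 \<and> d + j \<le> b}"
    using 3(3) by auto
  then show ?case using 3 regs by (simp add: algebra_simps)
qed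


text \<open>The loop over a row of \<open>B + 1\<close> cells makes \<open>B + 2\<close> tests, and
  so does the longest loop over splits. The value is at least 4 even for \<open>B = 0\<close>, which
  lets additive constants be absorbed.\<close>

definition quad :: "nat \<Rightarrow> nat" where
  "quad B = (B + 2) * (B + 2)"

lemma quad_ge: "4 \<le> quad B"
  by (simp add: quad_def)

definition row_ok :: "(nat \<Rightarrow> nat) \<Rightarrow> (nat \<Rightarrow> nat) \<Rightarrow> (nat \<Rightarrow> nat) \<Rightarrow> (nat \<Rightarrow> nat \<Rightarrow> nat \<Rightarrow> nat) \<Rightarrow> nat \<Rightarrow>
  nat \<Rightarrow> bool"
  where
  "row_ok F C D val q N \<longleftrightarrow> (\<forall>b<N. D (q + b) \<le> 1 \<and> D (q + b) + C (q + b) \<le> b \<and>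
     F (q + b) = val b (D (q + b)) (C (q + b)) \<and> (\<forall>d j. d \<le> 1 \<longrightarrow> d + j \<le> b \<longrightarrow> F (q + b) \<le> val b d j))"

lemma row_ok_cong:
  assumes "row_ok F C D val q N"
    and "\<And>i. i < q + N \<Longrightarrow> F' i = F i \<and> C' i = C i \<and> D' i = D i"
  shows "row_ok F' C' D' val q N"
  unfolding row_ok_def
proof (intro allI impI, goal_cases)
  case (1 b)
  then have eq: "F' (q + b) = F (q + b)" "C' (q + b) = C (q + b)" "D' (q + b) = D (q + b)"
    using assms(2)[of "q + b"] by auto
  show ?case unfolding eq using assms(1) 1 unfolding row_ok_def by blast
qed

lemma cand_val_cong:
  assumes "\<And>i. i < q \<Longrightarrow> F' i = F i" "a + b < q" "f + b < q" "g + b < q" "d + j \<le> b"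
  shows "cand_val F' a f g x y b d j = cand_val F a f g x y b d j"
  using assms unfolding cand_val_def by simp

lemma row_ok_Suc:
  assumes "row_ok F C D val q N" "D (q + N) \<le> 1" "D (q + N) + C (q + N) \<le> N"
    "F (q + N) = val N (D (q + N)) (C (q + N))" "\<And>d j. d \<le> 1 \<Longrightarrow> d + j \<le> N \<Longrightarrow> F (q + N) \<le> val N d j"
  shows "row_ok F C D val q (Suc N)"
  using assms unfolding row_ok_def by (auto simp: less_Suc_eq)

lemma written_split_loop:
  "written_regs split_loop = {''t'', ''j''}" "written_arrs split_loop = {''F'', ''C'', ''D''}"
  by (auto simp: split_loop_def written_candidate)

lemma wp_row_loop:
  assumes regs: "reg s\<^sub>0 ''a'' = a" "reg s\<^sub>0 ''f'' = f" "reg s\<^sub>0 ''g'' = g" "reg s\<^sub>0 ''x'' = x"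
    "reg s\<^sub>0 ''y'' = y"
      "reg s\<^sub>0 ''W'' = Suc B" "reg s\<^sub>0 ''q'' = q"
    and bounds: "a + B < q" "f + B < q" "g + B < q"
    and val: "val = cand_val (arr s\<^sub>0 ''F'') a f g x y"
  shows "wp row_loop s\<^sub>0 (\<lambda>t s. t \<le> 200 * quad B \<and> reg s ''q'' = q + Suc B \<and>
    (\<forall>i<q. arr s ''F'' i = arr s\<^sub>0 ''F'' i \<and> arr s ''C'' i = arr s\<^sub>0 ''C'' i \<and>
      arr s ''D'' i = arr s\<^sub>0 ''D'' i) \<and>
    row_ok (arr s ''F'') (arr s ''C'') (arr s ''D'') val q (Suc B))"
  unfolding row_loop_def wp_Seq[of "Assign _ _"] wp_Assign
proof (rule wp_While[where I = "\<lambda>s. reg s ''b'' \<le> Suc B \<and> reg s ''q'' = q + reg s ''b'' \<and>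
      (\<forall>i<q. arr s ''F'' i = arr s\<^sub>0 ''F'' i \<and> arr s ''C'' i = arr s\<^sub>0 ''C'' i \<and>
        arr s ''D'' i = arr s\<^sub>0 ''D'' i) \<and>
      row_ok (arr s ''F'') (arr s ''C'') (arr s ''D'') val q (reg s ''b'')"
      and \<mu> = "\<lambda>s. Suc B - reg s ''b''" and K = "(B + 2) * 100 + 50"], goal_cases)
  case 1
  show ?case using regs by (simp add: row_ok_def)
next
  case (2 s)
  let ?b = "reg s ''b''"
  let ?q = "q + ?b"
  have regs_s: "reg s ''a'' = a" "reg s ''f'' = f" "reg s ''g'' = g" "reg s ''x'' = x"
    "reg s ''y'' = y"
      "reg s ''W'' = Suc B"
    using 2(2) regs by (simp_all add: frame_def written_split_loop)
  have reg_q: "reg s ''q'' = ?q" using 2(1) by simp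
  have bB: "?b \<le> B" using 2(3) regs_s by simp
  have old: "arr s ''F'' i = arr s\<^sub>0 ''F'' i" if "i < q" for i using 2(1) that by simp
  define s1 where "s1 = set_reg ''j'' 0 (set_arr ''D'' ?q 0 (set_arr ''C'' ?q 0
    (set_arr ''F'' ?q (arr s ''F'' (a + ?b) + (arr s ''F'' f + x)) s)))"
  have old1: "arr s1 ''F'' i = arr s\<^sub>0 ''F'' i" if "i < q" for i using old that
    by (simp add: s1_def)
  have val1: "cand_val (arr s1 ''F'') a f g x y ?b d j = val ?b d j" if "d + j \<le> ?b" for d j
    unfolding val using old1 bounds bB that by (intro cand_val_cong[of q]) auto
  have loop: "wp split_loop s1 (\<lambda>t s. t \<le> (?b + 2) * 100 \<and>
    best s1 (cand_val (arr s1 ''F'') a f g x y ?b) ?b ?q s {(d, j). d \<le> 1 \<and> d + j \<le> ?b})"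
  proof (rule wp_split_loop[OF _ _ _ _ _ _ _ _ _ _ _ refl])
    show "best s1 (cand_val (arr s1 ''F'') a f g x y ?b) ?b ?q s1 {}"
      using bounds bB by (auto simp: best_def s1_def cand_val_def)
  qed (use regs_s reg_q bounds bB in \<open>auto simp: s1_def\<close>)
  have "wp split_loop s1 (\<lambda>t s'. wp (Assign ''q'' (Add (Reg ''q'')
    (Const 1)) ;; Assign ''b'' (Add (Reg ''b'') (Const 1))) s'
    (\<lambda>u s''. (reg s'' ''b'' \<le> Suc B \<and> reg s'' ''q'' = q + reg s'' ''b'' \<and>
      (\<forall>i<q. arr s'' ''F'' i = arr s\<^sub>0 ''F'' i \<and> arr s'' ''C'' i = arr s\<^sub>0 ''C'' i \<and>
        arr s'' ''D'' i = arr s\<^sub>0 ''D'' i) \<and>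
      row_ok (arr s'' ''F'') (arr s'' ''C'') (arr s'' ''D'') val q (reg s'' ''b'')) \<and>
      Suc B - reg s'' ''b'' < Suc B - ?b \<and> t + u + 30 \<le> (B + 2) * 100 + 50))"
    using loop
  proof (rule wp_conseq)
    fix t s2 assume t: "t \<le> (?b + 2) * 100 \<and>
      best s1 (cand_val (arr s1 ''F'') a f g x y ?b) ?b ?q s2 {(d, j). d \<le> 1 \<and> d + j \<le> ?b}"
      and fr: "frame split_loop s1 s2"
    have regs2: "reg s2 ''b'' = ?b" "reg s2 ''q'' = ?q"
      using fr reg_q by (simp_all add: frame_def written_split_loop s1_def)
    have other: "arr s2 ''F'' i = arr s ''F'' i \<and> arr s2 ''C'' i = arr s ''C'' i \<and>
      arr s2 ''D'' i = arr s ''D'' i"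
      if "i \<noteq> ?q" for i
      using t that unfolding best_def by (auto simp: s1_def)
    have new: "arr s2 ''D'' ?q \<le> 1" "arr s2 ''D'' ?q + arr s2 ''C'' ?q \<le> ?b"
      "arr s2 ''F'' ?q = val ?b (arr s2 ''D'' ?q) (arr s2 ''C'' ?q)"
      "\<And>d j. d \<le> 1 \<Longrightarrow> d + j \<le> ?b \<Longrightarrow> arr s2 ''F'' ?q \<le> val ?b d j"
      using t val1 unfolding best_def by (auto simp: val1)
    have "row_ok (arr s ''F'') (arr s ''C'') (arr s ''D'') val q ?b"
      using 2(1) by blast
    then have "row_ok (arr s2 ''F'') (arr s2 ''C'') (arr s2 ''D'') val q ?b"
      by (rule row_ok_cong) (rule other, simp)
    then have "row_ok (arr s2 ''F'') (arr s2 ''C'') (arr s2 ''D'') val q (Suc ?b)"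
      using new by (rule row_ok_Suc)
    moreover have "arr s2 ''F'' i = arr s\<^sub>0 ''F'' i \<and> arr s2 ''C'' i = arr s\<^sub>0 ''C'' i \<and>
      arr s2 ''D'' i = arr s\<^sub>0 ''D'' i"
      if "i < q" for i using other[of i] 2(1) that by simp
    moreover have "t \<le> (B + 2) * 100" using t bB by auto
    ultimately show "wp (Assign ''q'' (Add (Reg ''q'')
      (Const 1)) ;; Assign ''b'' (Add (Reg ''b'') (Const 1))) s2
    (\<lambda>u s''. (reg s'' ''b'' \<le> Suc B \<and> reg s'' ''q'' = q + reg s'' ''b'' \<and>
      (\<forall>i<q. arr s'' ''F'' i = arr s\<^sub>0 ''F'' i \<and> arr s'' ''C'' i = arr s\<^sub>0 ''C'' i \<and>
        arr s'' ''D'' i = arr s\<^sub>0 ''D'' i) \<and>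
      row_ok (arr s'' ''F'') (arr s'' ''C'') (arr s'' ''D'') val q (reg s'' ''b'')) \<and>
      Suc B - reg s'' ''b'' < Suc B - ?b \<and> t + u + 30 \<le> (B + 2) * 100 + 50)"
      using bB by (simp add: wp_simps regs2)
  qed
  then show ?case
    unfolding s1_def wp_Seq[of "Assign _ _"] wp_Seq[of "Store _ _ _"]
      wp_Seq[of split_loop] wp_Assign wp_Store
    by (simp add: regs_s reg_q) (erule wp_conseq, simp)
next
  case (3 t s)
  have "reg s ''b'' = Suc B"
    using 3 regs by (simp add: frame_def written_split_loop)
  then show ?case using 3 regs by (simp add: quad_def algebra_simps)
qed

section \<open>Programs for a merge and for the leaf scan\<close>

definition load_weight :: "vname \<Rightarrow> com" where
  "load_weight v = Cond (Equal (Arr ''ign'' (Reg v)) (Const 0))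
     (Assign ''x'' (Const 0)) (Assign ''x'' (Add (Reg ''n'') (Const 1)))"

text \<open>The first pass fills the row for \<open>False\<close> and leaves \<open>q\<close> at the
  start of the row for \<open>True\<close>. For the second pass the roles of equal and opposite
  colour are exchanged, so \<open>f\<close> and \<open>g\<close> as well as \<open>x\<close> and
  \<open>y\<close> swap.\<close>

definition merge_prog :: com where
  "merge_prog =
     Assign ''q'' (Reg ''off'') ;;
     Assign ''a'' (Arr ''base'' (Reg ''p'')) ;;
     Assign ''f'' (Arr ''base'' (Reg ''u'')) ;;
     Assign ''g'' (Add (Reg ''f'') (Reg ''W'')) ;;
     Assign ''y'' (Const 1) ;;
     load_weight ''u'' ;;
     row_loop ;;
     Assign ''a'' (Add (Reg ''a'') (Reg ''W'')) ;;
     Assign ''g'' (Reg ''f'') ;;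
     Assign ''f'' (Add (Reg ''f'') (Reg ''W'')) ;;
     Assign ''y'' (Reg ''x'') ;;
     Assign ''x'' (Const 1) ;;
     row_loop"

text \<open>The other end point of the edge is the sum of both minus \<open>u\<close>. Register
  \<open>r\<close> always names a remaining vertex, and hence the last one once all edges are
  gone.\<close>

definition elim_step :: com where
  "elim_step =
     Assign ''e'' (Arr ''T'' (Reg ''u'')) ;;
     Assign ''p'' (Sub (Add (Arr ''src'' (Reg ''e'')) (Arr ''dst'' (Reg ''e''))) (Reg ''u'')) ;;
     Store ''U'' (Reg ''k'') (Reg ''u'') ;;
     Store ''P'' (Reg ''k'') (Reg ''p'') ;;
     Store ''E'' (Reg ''k'') (Reg ''e'') ;;
     Store ''deg'' (Reg ''u'') (Const 0) ;;
     Store ''deg'' (Reg ''p'') (Sub (Arr ''deg'' (Reg ''p'')) (Const 1)) ;;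
     Store ''T'' (Reg ''p'') (Sub (Arr ''T'' (Reg ''p'')) (Reg ''e'')) ;;
     merge_prog ;;
     Store ''base'' (Reg ''p'') (Reg ''off'') ;;
     Assign ''off'' (Add (Reg ''off'') (Add (Reg ''W'') (Reg ''W''))) ;;
     Assign ''k'' (Add (Reg ''k'') (Const 1)) ;;
     Assign ''r'' (Reg ''p'') ;;
     Assign ''u'' (Reg ''p'')"

definition elim_loop :: com where
  "elim_loop = While (Less (Reg ''v'') (Reg ''n''))
     (Cond (Equal (Arr ''deg'' (Reg ''u'')) (Const 1)) elim_step
       (Assign ''v'' (Add (Reg ''v'') (Const 1)) ;; Assign ''u'' (Reg ''v'')))"

lemma written_row_loop:
  "written_regs row_loop = {''t'', ''j'', ''q'', ''b''}"
    "written_arrs row_loop = {''F'', ''C'', ''D''}"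
  by (auto simp: row_loop_def written_split_loop)

lemma written_merge_prog:
  "written_regs merge_prog = {''t'', ''j'', ''q'', ''b'', ''a'', ''f'', ''g'', ''x'', ''y''}"
  "written_arrs merge_prog = {''F'', ''C'', ''D''}"
  by (auto simp: merge_prog_def written_row_loop load_weight_def)

lemma row_ok_val:
  assumes "row_ok F C D val q N"
    and "\<And>b d j. b < N \<Longrightarrow> d + j \<le> b \<Longrightarrow> val' b d j = val b d j"
  shows "row_ok F C D val' q N"
  unfolding row_ok_def
proof (intro allI impI, goal_cases)
  case (1 b)
  then have "D (q + b) \<le> 1" "D (q + b) + C (q + b) \<le> b" "F (q + b) = val b (D (q + b)) (C (q + b))"
    "\<And>d j. d \<le> 1 \<Longrightarrow> d + j \<le> b \<Longrightarrow> F (q + b) \<le> val b d j"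
    using assms(1) unfolding row_ok_def by blast+
  then show ?case using assms(2)[OF 1] by presburger
qed

context cut_dp
begin

text \<open>This splits the specification by the colour of \<open>p\<close>, in line with the two
  passes of the program.\<close>

lemma merged_rows:
  "merged F C D bs u p off \<longleftrightarrow> (\<forall>c. row_ok F C D
     (cand_val F (bs p + row c) (bs u + row c) (bs u + row (\<not> c)) (w u c) (w u (\<not> c)))
       (off + row c) (Suc B))"
proof -
  have "split_val F bs u p c = cand_val F (bs p + row c) (bs u + row c) (bs u + row (\<not> c))
    (w u c) (w u (\<not> c))" for c
    by (intro ext) (simp add: split_val_def cand_val_def cost_def)
  then show ?thesis unfolding merged_def row_ok_def less_Suc_eq_le by simp
qed

definition prepared :: "store \<Rightarrow> bool" where
  "prepared s \<longleftrightarrow> reg s ''n'' = n \<and> reg s ''m'' = m \<and> reg s ''B'' = B \<and> reg s ''W'' = Suc B \<and>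
     (\<forall>i<m. arr s ''src'' i = sr i \<and> arr s ''dst'' i = ds i) \<and>
     (\<forall>v. w v False = (if arr s ''ign'' v = 0 then 0 else Suc n) \<and> w v True = 1)"

lemma wp_load_weight:
  assumes "prepared s" "\<And>t. t \<le> 9 \<Longrightarrow> Q t (set_reg ''x'' (w (reg s v) False) s)"
  shows "wp (load_weight v) s Q"
  using assms(1) assms(2)[of 7] assms(2)[of 9] unfolding load_weight_def prepared_def
  by (simp add: wp_simps numeral_eq_Suc split: if_splits)

lemma wp_merge_prog:
  assumes prepared: "prepared s\<^sub>0"
    and regs: "reg s\<^sub>0 ''u'' = u" "reg s\<^sub>0 ''p'' = p" "reg s\<^sub>0 ''off'' = off"
    and bs: "arr s\<^sub>0 ''base'' = bs"
    and bounds: "bs u + offset 0 \<le> off" "bs p + offset 0 \<le> off"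
  shows "wp merge_prog s\<^sub>0 (\<lambda>t s. t \<le> 500 * quad B \<and>
    merged (arr s ''F'') (arr s ''C'') (arr s ''D'') bs u p off \<and>
    (\<forall>i<off. arr s ''F'' i = arr s\<^sub>0 ''F'' i \<and> arr s ''C'' i = arr s\<^sub>0 ''C'' i \<and>
      arr s ''D'' i = arr s\<^sub>0 ''D'' i))"
proof -
  define s1 where "s1 = set_reg ''x'' (w u False) (set_reg ''y'' (w u True)
    (set_reg ''g'' (bs u + Suc B)
    (set_reg ''f'' (bs u) (set_reg ''a'' (bs p) (set_reg ''q'' off s\<^sub>0)))))"
  define s2' where "s2' s = set_reg ''x'' (w u True) (set_reg ''y'' (w u False)
    (set_reg ''f'' (bs u + Suc B)
    (set_reg ''g'' (bs u) (set_reg ''a'' (bs p + Suc B) s))))" for s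
  note st = prepared[unfolded prepared_def]
  have loop1: "wp row_loop s1 (\<lambda>t s. t \<le> 200 * quad B \<and> reg s ''q'' = off + Suc B \<and>
    (\<forall>i<off. arr s ''F'' i = arr s1 ''F'' i \<and> arr s ''C'' i = arr s1 ''C'' i \<and>
      arr s ''D'' i = arr s1 ''D'' i) \<and>
    row_ok (arr s ''F'') (arr s ''C'') (arr s ''D'')
      (cand_val (arr s1 ''F'') (bs p) (bs u) (bs u + Suc B) (w u False) (w u True)) off (Suc B))"
    by (rule wp_row_loop[OF _ _ _ _ _ _ _ _ _ _ refl]) (use bounds st in \<open>simp_all add: s1_def\<close>)
  let ?post = "\<lambda>t s. t \<le> 450 * quad B \<and>
    merged (arr s ''F'') (arr s ''C'') (arr s ''D'') bs u p off \<and>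
    (\<forall>i<off. arr s ''F'' i = arr s\<^sub>0 ''F'' i \<and> arr s ''C'' i = arr s\<^sub>0 ''C'' i \<and>
      arr s ''D'' i = arr s\<^sub>0 ''D'' i)"
  have main: "wp row_loop s1 (\<lambda>t s. reg s ''a'' = bs p \<and> reg s ''f'' = bs u \<and>
    reg s ''x'' = w u False \<and>
    reg s ''W'' = Suc B \<and> wp row_loop (s2' s) (\<lambda>t'. ?post (t + t')))"
    using loop1
  proof (rule wp_conseq, goal_cases)
    case (1 t s)
    have regs_s: "reg s ''a'' = bs p" "reg s ''f'' = bs u" "reg s ''x'' = w u False"
      "reg s ''W'' = Suc B"
      using 1(2) st by (simp_all add: frame_def written_row_loop s1_def)
    have loop2: "wp row_loop (s2' s) (\<lambda>t s3. t \<le> 200 * quad B \<and>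
      reg s3 ''q'' = (off + Suc B) + Suc B \<and>
      (\<forall>i<off + Suc B. arr s3 ''F'' i = arr (s2' s) ''F'' i \<and>
        arr s3 ''C'' i = arr (s2' s) ''C'' i \<and> arr s3 ''D'' i = arr (s2' s) ''D'' i) \<and>
      row_ok (arr s3 ''F'') (arr s3 ''C'') (arr s3 ''D'')
        (cand_val (arr (s2' s) ''F'') (bs p + Suc B) (bs u + Suc B) (bs u) (w u True)
          (w u False)) (off + Suc B) (Suc B))"
      by (rule wp_row_loop[OF _ _ _ _ _ _ _ _ _ _ refl]) (use bounds 1 regs_s
        in \<open>simp_all add: s2'_def\<close>)
    have "wp row_loop (s2' s) (\<lambda>t'. ?post (t + t'))"
      using loop2
    proof (rule wp_conseq, goal_cases)
      case (1 t' s3)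
      have arrs: "arr s1 = arr s\<^sub>0" "arr (s2' s) = arr s" by (simp_all add: s1_def s2'_def)
      have same: "arr s3 ''F'' i = arr s ''F'' i \<and> arr s3 ''C'' i = arr s ''C'' i \<and>
        arr s3 ''D'' i = arr s ''D'' i"
        if "i < off + Suc B" for i using 1(1) that unfolding arrs by blast
      have same0: "arr s3 ''F'' i = arr s\<^sub>0 ''F'' i \<and> arr s3 ''C'' i = arr s\<^sub>0 ''C'' i \<and>
        arr s3 ''D'' i = arr s\<^sub>0 ''D'' i"
        if "i < off" for i using same[of i] \<open>t \<le> _ \<and> _\<close> that unfolding arrs by simp
      have rowF: "row_ok (arr s ''F'') (arr s ''C'') (arr s ''D'')
        (cand_val (arr s\<^sub>0 ''F'') (bs p) (bs u) (bs u + Suc B) (w u False) (w u True)) off (Suc B)"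
        using \<open>t \<le> _ \<and> _\<close> unfolding arrs by blast
      have "row_ok (arr s3 ''F'') (arr s3 ''C'') (arr s3 ''D'')
        (cand_val (arr s\<^sub>0 ''F'') (bs p) (bs u) (bs u + Suc B) (w u False) (w u True)) off (Suc B)"
        by (rule row_ok_cong[OF rowF]) (rule same, simp)
      \<comment> \<open>The value function still refers to the table before the merge; since the
        rows it reads end below \<open>off\<close>, it can be restated for the final table.\<close>
      then have "row_ok (arr s3 ''F'') (arr s3 ''C'') (arr s3 ''D'')
        (cand_val (arr s3 ''F'') (bs p) (bs u) (bs u + Suc B) (w u False) (w u True)) off (Suc B)"
        by (rule row_ok_val, intro cand_val_cong[of off]) (use same0 bounds in auto)
      moreover have "row_ok (arr s3 ''F'') (arr s3 ''C'') (arr s3 ''D'')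
        (cand_val (arr s ''F'') (bs p + Suc B) (bs u + Suc B) (bs u) (w u True) (w u False))
          (off + Suc B) (Suc B)"
        using 1(1) unfolding arrs by blast
      then have "row_ok (arr s3 ''F'') (arr s3 ''C'') (arr s3 ''D'')
        (cand_val (arr s3 ''F'') (bs p + Suc B) (bs u + Suc B) (bs u) (w u True) (w u False))
          (off + Suc B) (Suc B)"
        by (rule row_ok_val, intro cand_val_cong[of off]) (use same bounds in auto)
      ultimately have "merged (arr s3 ''F'') (arr s3 ''C'') (arr s3 ''D'') bs u p off"
        unfolding merged_rows all_bool_eq by simp
      moreover have "t + t' \<le> 450 * quad B"
        using 1(1) \<open>t \<le> _ \<and> _\<close> by simp
      ultimately show ?case using same0 by blast
    qed
    with regs_s show ?case by blast
  qed
  have time: "450 * quad B + 50 \<le> 500 * quad B" using quad_ge[of B] by linarith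
  have weights: "w u True = 1" using st by simp
  show ?thesis
    unfolding merge_prog_def
    apply (simp add: wp_Seq wp_Assign regs bs st)
    apply (rule wp_load_weight)
     apply (simp add: st prepared_def)
    apply (simp add: regs)
    apply (rule wp_conseq[OF main[unfolded s1_def weights One_nat_def add_Suc_right]])
    apply (simp add: s2'_def weights)
    apply (elim conjE, erule wp_conseq)
    using time apply simp
    done
qed

end

lemma written_elim_step:
  "written_regs elim_step = {''e'', ''p'', ''off'', ''k'', ''r'', ''u'', ''t'', ''j'', ''q'',
    ''b'', ''a'', ''f'', ''g'', ''x'', ''y''}"
  "written_arrs elim_step = {''U'', ''P'', ''E'', ''deg'', ''T'', ''base'', ''F'', ''C'', ''D''}"
  by (auto simp: elim_step_def written_merge_prog)

section \<open>Invariants of the elimination phase\<close>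

context cut_dp
begin

definition inc :: "nat set \<Rightarrow> nat \<Rightarrow> nat set" where
  "inc I v = {i \<in> I. sr i = v \<or> ds i = v}"

text \<open>Degrees are tracked for all vertices, so degree 1 already implies that a vertex remains.
  The entries of \<open>T\<close> are tracked on \<open>R\<close> only, because that of an
  eliminated leaf is left stale.\<close>

definition elim_state :: "store \<Rightarrow> nat set \<Rightarrow> nat set \<Rightarrow> bool" where
  "elim_state s R I \<longleftrightarrow> prepared s \<and> elim (arr s) (reg s ''k'') R I (arr s ''base'') \<and>
     reg s ''off'' = offset (reg s ''k'') \<and> reg s ''r'' \<in> R \<and>
     (\<forall>x<n. arr s ''deg'' x = card (inc I x)) \<and> (\<forall>x\<in>R. arr s ''T'' x = \<Sum> (inc I x))"

text \<open>The last conjunct makes the leaf search linear: a vertex of degree 1 after the step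
  either had degree 1 before or is the neighbour \<open>p\<close>, now held in register
  \<open>u\<close>.\<close>

lemma wp_elim_step:
  assumes state: "elim_state s\<^sub>0 R I" and u: "reg s\<^sub>0 ''u'' = u" "u < n" "arr s\<^sub>0 ''deg'' u = 1"
  shows "wp elim_step s\<^sub>0 (\<lambda>t s. t \<le> 600 * quad B \<and> (\<exists>R I. elim_state s R I) \<and>
    reg s ''k'' = Suc (reg s\<^sub>0 ''k'') \<and> reg s\<^sub>0 ''k'' < n \<and> reg s ''u'' < n \<and>
    (\<forall>x<n. arr s ''deg'' x = 1 \<longrightarrow> arr s\<^sub>0 ''deg'' x = 1 \<and> x \<noteq> u \<or> x = reg s ''u''))"
proof -
  define k where "k = reg s\<^sub>0 ''k''"
  define bs where "bs = arr s\<^sub>0 ''base''"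
  have prep: "prepared s\<^sub>0" and elim: "elim (arr s\<^sub>0) k R I bs"
    and off: "reg s\<^sub>0 ''off'' = offset k"
    and deg: "\<And>x. x < n \<Longrightarrow> arr s\<^sub>0 ''deg'' x = card (inc I x)"
    and T: "\<And>x. x \<in> R \<Longrightarrow> arr s\<^sub>0 ''T'' x = \<Sum> (inc I x)"
    using state unfolding elim_state_def k_def bs_def by auto
  note facts = elim_facts[OF elim]
  have fin: "finite R" "finite I" using facts by (auto intro: finite_subset)
  obtain e where inc_u: "inc I u = {e}"
    using deg[OF u(2)] u(3) by (metis card_1_singletonE)
  then have e: "e \<in> I" "sr e = u \<or> ds e = u" unfolding inc_def by auto
  then have "e < m" using facts by auto
  define p where "p = sr e + ds e - u"
  have up: "{sr e, ds e} = {u, p}" "u \<noteq> p" "u \<in> R" "p \<in> R" "p < n"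
    using e ends[OF \<open>e < m\<close>] facts(5)[OF \<open>e \<in> I\<close>] unfolding p_def by auto
  have other: "sr i \<noteq> u \<and> ds i \<noteq> u" if "i \<in> I - {e}" for i
    using inc_u that unfolding inc_def by blast
  have Tu: "arr s\<^sub>0 ''T'' u = e" using T[OF up(3)] inc_u by simp
  have src: "arr s\<^sub>0 ''src'' e = sr e" "arr s\<^sub>0 ''dst'' e = ds e" "reg s\<^sub>0 ''W'' = Suc B"
    using prep \<open>e < m\<close> unfolding prepared_def by auto
  have "0 < card R" using fin up by (auto simp: card_gt_0_iff)
  then have "k < n" using facts(3) by simp
  define s1 where "s1 =
    set_arr ''T'' p (arr s\<^sub>0 ''T'' p - e) (set_arr ''deg'' p (arr s\<^sub>0 ''deg'' p - 1)
      (set_arr ''deg'' u 0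
    (set_arr ''E'' k e (set_arr ''P'' k p (set_arr ''U'' k u (set_reg ''p'' p
      (set_reg ''e'' e s\<^sub>0)))))))"
  have inc': "inc (I - {e}) x = (if x = u then {} else if x =
    p then inc I p - {e} else inc I x)" for x
    using inc_u up(1) unfolding inc_def by (auto simp: doubleton_eq_iff)
  have e_p: "e \<in> inc I p" using up e unfolding inc_def by (auto simp: doubleton_eq_iff)
  have fin_inc: "finite (inc I x)" for x using fin unfolding inc_def by simp
  have deg1: "arr s1 ''deg'' x = card (inc (I - {e}) x)" if "x < n" for x
    using deg[OF that] deg[OF up(5)] up e_p fin_inc unfolding inc' by (simp add: s1_def)
  have T1: "arr s1 ''T'' x = \<Sum> (inc (I - {e}) x)" if "x \<in> R - {u}" for x
    using T[of x] T[OF up(4)] that up e_p fin_inc unfolding inc' by (simp add: s1_def sum_diff1_nat)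
  define final where "final s = set_reg ''u'' p (set_reg ''r'' p (set_reg ''k'' (Suc k)
    (set_reg ''off'' (offset k + (Suc B + Suc B)) (set_arr ''base'' p (offset k) s))))" for s
  have prep1: "prepared s1"
    using prep unfolding prepared_def s1_def by simp
  have merge: "wp merge_prog s1 (\<lambda>t s. t \<le> 500 * quad B \<and>
    merged (arr s ''F'') (arr s ''C'') (arr s ''D'') bs u p (offset k) \<and>
    (\<forall>i<offset k. arr s ''F'' i = arr s1 ''F'' i \<and> arr s ''C'' i = arr s1 ''C'' i \<and>
      arr s ''D'' i = arr s1 ''D'' i))"
    by (rule wp_merge_prog[OF prep1])
      (use u off facts(6) in \<open>simp_all add: s1_def bs_def del: mult_Suc mult_Suc_right\<close>)
  have main: "wp merge_prog s1 (\<lambda>t s. t \<le> 500 * quad B \<and> reg s ''p'' = p \<and>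
    reg s ''off'' = offset k \<and>
    reg s ''W'' = Suc B \<and> reg s ''k'' = k \<and> arr s ''deg'' = arr s1 ''deg'' \<and>
    elim_state (final s) (R - {u}) (I - {e}))"
    using merge
  proof (rule wp_conseq, goal_cases)
    case (1 t s)
    have regs: "reg s ''p'' = p" "reg s ''off'' = offset k" "reg s ''W'' = Suc B" "reg s ''k'' = k"
      using 1(2) off src k_def by (simp_all add: frame_def written_merge_prog s1_def)
    have arrs: "arr s a = arr s1 a" if "a \<notin> {''F'', ''C'', ''D''}" for a
      using 1(2) that by (simp add: frame_def written_merge_prog)
    have "elim (arr s) k R I bs"
    proof (rule elim_cong[OF elim])
      show "i < k \<Longrightarrow> arr s ''U'' i = arr s\<^sub>0 ''U'' i \<and> arr s ''P'' i = arr s\<^sub>0 ''P'' i \<and>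
        arr s ''E'' i = arr s\<^sub>0 ''E'' i" for i
        by (simp add: arrs) (simp add: s1_def)
      show "i < offset k \<Longrightarrow> arr s ''F'' i = arr s\<^sub>0 ''F'' i \<and> arr s ''C'' i = arr s\<^sub>0 ''C'' i \<and>
        arr s ''D'' i = arr s\<^sub>0 ''D'' i" for i
        using 1(1) by (simp add: s1_def del: mult_Suc mult_Suc_right)
    qed
    then have "elim (arr s) (Suc k) (R - {u}) (I - {e}) (bs(p := offset k))"
    proof (rule elim_Suc)
      show "arr s ''U'' k = u" "arr s ''P'' k = p" "arr s ''E'' k = e"
        by (simp_all add: arrs) (simp_all add: s1_def)
    qed (use up e other 1(1) in blast)+
    then have "elim (arr (final s)) (Suc k) (R - {u}) (I - {e}) (bs(p := offset k))"
      by (rule elim_cong) (simp_all add: final_def)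
    moreover have "arr s ''base'' = bs" by (simp add: arrs) (simp add: s1_def bs_def)
    moreover have "prepared s"
      using prep1 1(2) unfolding prepared_def by (simp add: frame_def written_merge_prog)
    then have "prepared (final s)"
      unfolding prepared_def by (simp add: final_def)
    ultimately have "elim_state (final s) (R - {u}) (I - {e})"
      using deg1 T1 up unfolding elim_state_def by (simp add: final_def arrs)
    then show ?case using regs 1(1) by (simp add: arrs)
  qed
  have time: "500 * quad B + 80 \<le> 600 * quad B" using quad_ge[of B] by linarith
  show ?thesis
    unfolding elim_step_def
    apply (simp add: wp_Seq wp_Assign wp_Store Tu src u(1) up(2) up(2)[symmetric] flip: k_def p_def)
    apply (rule wp_conseq[OF main[unfolded s1_def One_nat_def]])
    subgoal for t s
      using time up \<open>k < n\<close> unfolding final_def by (auto split: if_splits)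
    done
qed

end

section \<open>Degrees, the last vertex, and backtracking\<close>

definition degree_loop :: com where
  "degree_loop = While (Less (Reg ''i'') (Reg ''m''))
     (Assign ''z'' (Arr ''src'' (Reg ''i'')) ;;
      Store ''deg'' (Reg ''z'') (Add (Arr ''deg'' (Reg ''z'')) (Const 1)) ;;
      Store ''T'' (Reg ''z'') (Add (Arr ''T'' (Reg ''z'')) (Reg ''i'')) ;;
      Assign ''z'' (Arr ''dst'' (Reg ''i'')) ;;
      Store ''deg'' (Reg ''z'') (Add (Arr ''deg'' (Reg ''z'')) (Const 1)) ;;
      Store ''T'' (Reg ''z'') (Add (Arr ''T'' (Reg ''z'')) (Reg ''i'')) ;;
      Assign ''i'' (Add (Reg ''i'') (Const 1)))"

definition finish_prog :: com where
  "finish_prog =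
     load_weight ''r'' ;;
     Assign ''z'' (Arr ''base'' (Reg ''r'')) ;;
     Assign ''a'' (Add (Reg ''x'') (Arr ''F'' (Add (Reg ''z'') (Reg ''B'')))) ;;
     Assign ''b'' (Add (Const 1) (Arr ''F'' (Add (Add (Reg ''z'') (Reg ''W'')) (Reg ''B'')))) ;;
     Store ''bud'' (Reg ''r'') (Reg ''B'') ;;
     Cond (Less (Reg ''a'') (Reg ''b''))
       (Assign ''saved'' (Sub (Reg ''n'') (Reg ''a'')))
       (Store ''lab'' (Reg ''r'') (Const 1) ;; Assign ''saved'' (Sub (Reg ''n'') (Reg ''b'')))"

definition backtrack_step :: com where
  "backtrack_step =
     Assign ''k'' (Sub (Reg ''k'') (Const 1)) ;;
     Assign ''off'' (Sub (Reg ''off'') (Add (Reg ''W'') (Reg ''W''))) ;;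
     Assign ''u'' (Arr ''U'' (Reg ''k'')) ;;
     Assign ''p'' (Arr ''P'' (Reg ''k'')) ;;
     Assign ''q'' (Add (Reg ''off'') (Arr ''bud'' (Reg ''p''))) ;;
     Cond (Equal (Arr ''lab'' (Reg ''p'')) (Const 0)) Skip (Assign ''q'' (Add (Reg ''q'')
       (Reg ''W''))) ;;
     Store ''bud'' (Reg ''u'') (Arr ''C'' (Reg ''q'')) ;;
     Store ''bud'' (Reg ''p'') (Sub (Arr ''bud'' (Reg ''p'')) (Add (Arr ''D'' (Reg ''q''))
       (Arr ''C'' (Reg ''q'')))) ;;
     Cond (Equal (Arr ''D'' (Reg ''q'')) (Const 0))
       (Store ''lab'' (Reg ''u'') (Arr ''lab'' (Reg ''p'')))
       (Store ''lab'' (Reg ''u'') (Sub (Const 1) (Arr ''lab'' (Reg ''p''))) ;;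
        Store ''cut'' (Arr ''E'' (Reg ''k'')) (Const 1))"

definition backtrack_loop :: com where
  "backtrack_loop = While (Less (Const 0) (Reg ''k'')) backtrack_step"

lemma written_elim_loop:
  "written_regs elim_loop = {''v'', ''e'', ''p'', ''off'', ''k'', ''r'', ''u'', ''t'', ''j'',
    ''q'', ''b'', ''a'', ''f'', ''g'', ''x'', ''y''}"
  "written_arrs elim_loop = {''U'', ''P'', ''E'', ''deg'', ''T'', ''base'', ''F'', ''C'', ''D''}"
  by (auto simp: elim_loop_def written_elim_step)

lemma written_backtrack_step:
  "written_regs backtrack_step = {''k'', ''off'', ''u'', ''p'', ''q''}"
  "written_arrs backtrack_step = {''bud'', ''lab'', ''cut''}"
  by (auto simp: backtrack_step_def)

context cut_dp
begin

text \<open>Every round advances \<open>v\<close> or \<open>k\<close>, each at most \<open>n\<close>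
  times. Among the vertices up to \<open>v\<close>, only the current \<open>u\<close> may have
  degree 1; at the end both registers equal \<open>n\<close>, so no such vertex is left.\<close>

lemma wp_elim_loop:
  assumes state: "elim_state s\<^sub>0 R\<^sub>0 I\<^sub>0" and regs: "reg s\<^sub>0 ''k'' = 0" "reg s\<^sub>0 ''v'' = 0"
    "reg s\<^sub>0 ''u'' = 0" "0 < n"
  shows "wp elim_loop s\<^sub>0 (\<lambda>t s. t \<le> (2 * n + 1) * (610 * quad B) \<and>
    (\<exists>R I. elim_state s R I \<and> (\<forall>x<n. card (inc I x) \<noteq> 1)))"
  unfolding elim_loop_def
proof (rule wp_While[where I = "\<lambda>s. (\<exists>R I. elim_state s R I) \<and> reg s ''k'' \<le> n \<and>
      (reg s ''v'' < n \<and> reg s ''u'' < n \<or> reg s ''v'' = n \<and> reg s ''u'' = n) \<and>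
      (\<forall>x\<le>reg s ''v''. x < n \<longrightarrow> arr s ''deg'' x = 1 \<longrightarrow> x = reg s ''u'')"
      and \<mu> = "\<lambda>s. (n - reg s ''v'') + (n - reg s ''k'')" and K = "600 * quad B + 20"], goal_cases)
  case 1
  show ?case using state regs by auto
next
  case (2 s)
  obtain R I where st: "elim_state s R I" using 2(1) by blast
  then have n: "reg s ''n'' = n" unfolding elim_state_def prepared_def by blast
  then have vu: "reg s ''v'' < n" "reg s ''u'' < n" using 2 by auto
  show ?case
  proof (cases "arr s ''deg'' (reg s ''u'') = 1")
    case True
    show ?thesis
      unfolding wp_Cond bval.simps aval.simps if_P[OF True]
    proof (rule wp_conseq[OF wp_elim_step[OF st refl vu(2) True]], goal_cases)
      case (1 t s')
      have "reg s' ''v'' = reg s ''v''" using 1(2) by (simp add: frame_def written_elim_step)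
      moreover have "\<forall>x\<le>reg s ''v''. x < n \<longrightarrow> arr s' ''deg'' x = 1 \<longrightarrow> x = reg s' ''u''"
        using 1(1) 2(1) by blast
      ultimately show ?case using 1(1) vu by auto
    qed
  next
    case False
    have "elim_state (set_reg ''u'' (Suc (reg s ''v'')) (set_reg ''v'' (Suc (reg s ''v'')) s)) R I"
      using st unfolding elim_state_def prepared_def by simp
    moreover have "x = Suc (reg s ''v'')" if "x \<le> Suc (reg s ''v'')" "x < n"
      "arr s ''deg'' x = Suc 0" for x
      using 2(1) False that by (metis One_nat_def le_SucE)
    ultimately show ?thesis
      using False vu 2(1) by (auto simp: wp_simps)
  qed
next
  case (3 t s)
  then obtain R I where st: "elim_state s R I" by blast
  then have n: "reg s ''n'' = n" unfolding elim_state_def prepared_def by blast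
  have "reg s ''v'' = n" "reg s ''u'' = n" using 3(1,3) n by auto
  then have "\<forall>x<n. card (inc I x) \<noteq> 1"
    using 3(1) st unfolding elim_state_def by (metis less_imp_le less_irrefl)
  moreover have "600 * quad B + 20 + bcost (Less (Reg ''v'') (Reg ''n'')) + 1 \<le> 610 * quad B"
    using quad_ge[of B] by simp
  then have "t \<le> (2 * n + 1) * (610 * quad B)"
    using 3(4) regs by (intro le_trans[OF 3(4)] mult_le_mono) auto
  ultimately show ?case using st by blast
qed

lemma wp_degree_loop:
  assumes prep: "prepared s\<^sub>0" and zero: "reg s\<^sub>0 ''i'' = 0" "arr s\<^sub>0 ''deg'' = (\<lambda>_. 0)"
    "arr s\<^sub>0 ''T'' = (\<lambda>_. 0)"
  shows "wp degree_loop s\<^sub>0 (\<lambda>t s. t \<le> (m + 1) * 100 \<and>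
    (\<forall>x. arr s ''deg'' x = card (inc {..<m} x) \<and> arr s ''T'' x = \<Sum> (inc {..<m} x)))"
  unfolding degree_loop_def
proof (rule wp_While[where I = "\<lambda>s. reg s ''i'' \<le> m \<and>
      (\<forall>x. arr s ''deg'' x = card (inc {..<reg s ''i''} x) \<and>
        arr s ''T'' x = \<Sum> (inc {..<reg s ''i''} x))"
      and \<mu> = "\<lambda>s. m - reg s ''i''" and K = 90], goal_cases)
  case 1
  show ?case using zero by (simp add: inc_def)
next
  case (2 s)
  let ?i = "reg s ''i''"
  have "reg s ''m'' = m" "\<forall>i<m. arr s ''src'' i = sr i \<and> arr s ''dst'' i = ds i"
    using prep 2(2) unfolding prepared_def by (simp_all add: frame_def)
  then have im: "?i < m" and ends_i: "arr s ''src'' ?i = sr ?i" "arr s ''dst'' ?i = ds ?i"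
    using 2(3) by auto
  have inc_Suc: "inc {..<Suc ?i} x = (if x = sr ?i \<or> x =
    ds ?i then insert ?i (inc {..<?i} x) else inc {..<?i} x)" for x
    unfolding inc_def by (auto simp: less_Suc_eq)
  have "finite (inc {..<?i} x)" "?i \<notin> inc {..<?i} x" for x unfolding inc_def by auto
  \<comment> \<open>The end points differ, so the two updates hit distinct vertices and each of them
    counts the edge once.\<close>
  then show ?case
    using 2(1) im ends[OF im] by (auto simp: wp_simps ends_i inc_Suc)
next
  case (3 t s)
  have "reg s ''m'' = m" using prep 3(2) unfolding prepared_def by (simp add: frame_def)
  then have "reg s ''i'' = m" using 3 by simp
  then show ?case using 3 zero by auto
qed

text \<open>With one vertex and no edge, \<open>fits\<close> forces the share \<open>B\<close>, so
  just two table entries compete. The array \<open>lab\<close> is zero at the start, which encodes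
  \<open>False\<close>; only the other colour has to be stored.\<close>

lemma wp_finish_prog:
  assumes state: "elim_state s\<^sub>0 {reg s\<^sub>0 ''r''} {}"
    and zero: "arr s\<^sub>0 ''lab'' = (\<lambda>_. 0)"
  shows "wp finish_prog s\<^sub>0 (\<lambda>t s. t \<le> 60 \<and> (\<exists>X.
    fits (arr s ''F'') {reg s\<^sub>0 ''r''} {} (arr s ''base'') (\<lambda>v. arr s ''lab'' v \<noteq> 0)
      (arr s ''bud'') X \<and>
    reg s ''saved'' = n - X \<and>
    (\<forall>L \<beta> Y. fits (arr s ''F'') {reg s\<^sub>0 ''r''} {} (arr s ''base'') L \<beta> Y \<longrightarrow> X \<le> Y)))"
proof -
  have prep: "prepared s\<^sub>0" using state unfolding elim_state_def by blast
  note st = prep[unfolded prepared_def]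
  show ?thesis
    unfolding finish_prog_def wp_Seq[of "load_weight _"]
  proof (rule wp_load_weight[OF prep], goal_cases)
    case (1 t)
    then show ?case
      using st zero
      by (auto simp: wp_simps fits_def bich_def cost_def add_ac split: if_splits)
  qed
qed

lemma wp_backtrack_step:
  assumes elim: "elim (arr s) k R I bs" and step: "arr s ''U'' k = u" "arr s ''P'' k = p"
    "arr s ''E'' k = e"
      "u \<in> R" "p \<in> R" "u \<noteq> p" "e \<in> I" "{sr e, ds e} = {u, p}"
      "\<And>i. i \<in> I - {e} \<Longrightarrow> sr i \<noteq> u \<and> ds i \<noteq> u"
      "merged (arr s ''F'') (arr s ''C'') (arr s ''D'') bs u p (offset k)"
    and fits: "fits (arr s ''F'') (R - {u}) (I - {e}) (bs(p := offset k))
      (\<lambda>v. arr s ''lab'' v \<noteq> 0) (arr s ''bud'') X"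
    and regs: "reg s ''k'' = Suc k" "reg s ''off'' = offset (Suc k)" "reg s ''W'' = Suc B"
    and cut: "\<And>i. arr s ''cut'' i \<noteq> 0 \<longleftrightarrow> i \<in> I - {e} \<and>
      (arr s ''lab'' (sr i) \<noteq> 0) \<noteq> (arr s ''lab'' (ds i) \<noteq> 0)"
  shows "wp backtrack_step s (\<lambda>t s'. t \<le> 90 \<and> reg s' ''k'' = k \<and> reg s' ''off'' = offset k \<and>
    fits (arr s ''F'') R I bs (\<lambda>v. arr s' ''lab'' v \<noteq> 0) (arr s' ''bud'') X \<and>
    (\<forall>i. arr s' ''cut'' i \<noteq> 0 \<longleftrightarrow> i \<in> I \<and> (arr s' ''lab'' (sr i) \<noteq> 0) \<noteq> (arr s' ''lab'' (ds i) \<noteq> 0)))"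
proof -
  let ?L = "\<lambda>v. arr s ''lab'' v \<noteq> 0"
  define q where "q = offset k + row (?L p) + arr s ''bud'' p"
  define lab' where "lab' = (arr s ''lab'')(u := if arr s ''D'' q =
    0 then arr s ''lab'' p else 1 - arr s ''lab'' p)"
  define bud' where "bud' = (arr s ''bud'')(u := arr s ''C'' q, p := arr s ''bud'' p -
    (arr s ''D'' q + arr s ''C'' q))"
  define cut' where "cut' = (if arr s ''D'' q = 0 then arr s ''cut'' else (arr s ''cut'')(e := 1))"
  \<comment> \<open>A label is read through the test for being nonzero, and truncated
    \<open>1 - l\<close> negates this test for every natural number \<open>l\<close>.\<close>
  have L': "(\<lambda>v. lab' v \<noteq> 0) = ?L(u := (if arr s ''D'' q = 0 then ?L p else \<not> ?L p))"
    unfolding lab'_def by auto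
  have fits': "fits (arr s ''F'') R I bs (\<lambda>v. lab' v \<noteq> 0) bud' X"
    by (rule fits_extend[OF elim step(4-10) fits q_def L' bud'_def])
  have cut_i: "cut' i \<noteq> 0 \<longleftrightarrow> i \<in> I \<and> (lab' (sr i) \<noteq> 0) \<noteq> (lab' (ds i) \<noteq> 0)" for i
  proof (cases "i = e")
    case True
    then show ?thesis
      using cut[of e] step(6-8) unfolding cut'_def lab'_def by (auto simp: doubleton_eq_iff)
  next
    case False
    then show ?thesis
      using cut[of i] step(9)[of i] unfolding cut'_def lab'_def by auto
  qed
  define o\<^sub>k where "o\<^sub>k = offset k"
  have off: "reg s ''off'' = o\<^sub>k + (Suc B + Suc B)" unfolding regs o\<^sub>k_def by simp
  have q: "q = (if arr s ''lab'' p =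
    0 then o\<^sub>k + arr s ''bud'' p else o\<^sub>k + arr s ''bud'' p + Suc B)"
    unfolding q_def o\<^sub>k_def by simp
  have "wp backtrack_step s (\<lambda>t s'. t \<le> 90 \<and> reg s' ''k'' = k \<and> reg s' ''off'' = o\<^sub>k \<and>
    arr s' ''lab'' = lab' \<and> arr s' ''bud'' = bud' \<and> arr s' ''cut'' = cut')"
  proof (cases "arr s ''lab'' p = 0")
    case True
    then show ?thesis
      unfolding backtrack_step_def lab'_def bud'_def cut'_def q
      using step(1-3,6) by (simp add: wp_simps regs(1,3) off)
  next
    case False
    then show ?thesis
      unfolding backtrack_step_def lab'_def bud'_def cut'_def q
      using step(1-3,6) by (simp add: wp_simps regs(1,3) off)
  qed
  then show ?thesis
    by (rule wp_conseq) (use fits' cut_i in \<open>simp add: o\<^sub>k_def del: mult_Suc mult_Suc_right\<close>)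
qed

end

section \<open>The complete program\<close>

definition main_prog :: com where
  "main_prog =
     Assign ''W'' (Add (Reg ''B'') (Const 1)) ;;
     degree_loop ;;
     Assign ''off'' (Add (Reg ''W'') (Reg ''W'')) ;;
     elim_loop ;;
     finish_prog ;;
     backtrack_loop"

context cut_dp
begin

definition cut_labels :: "store \<Rightarrow> nat set \<Rightarrow> bool" where
  "cut_labels s I \<longleftrightarrow> (\<forall>i. arr s ''cut'' i \<noteq> 0 \<longleftrightarrow>
     i \<in> I \<and> (arr s ''lab'' (sr i) \<noteq> 0) \<noteq> (arr s ''lab'' (ds i) \<noteq> 0))"

text \<open>The history is stated for the arrays of \<open>s\<^sub>0\<close>, none of which
  backtracking touches, while \<open>R\<close>, \<open>I\<close> and \<open>bs\<close> are
  existential and regrow by inversion of \<open>elim\<close>. At \<open>k = 0\<close> the colouring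
  covers all vertices and edges.\<close>

lemma wp_backtrack_loop:
  assumes elim: "elim (arr s\<^sub>0) k R I bs"
    and fits: "fits (arr s\<^sub>0 ''F'') R I bs (\<lambda>v. arr s\<^sub>0 ''lab'' v \<noteq> 0) (arr s\<^sub>0 ''bud'') X"
    and regs: "reg s\<^sub>0 ''k'' = k" "reg s\<^sub>0 ''off'' = offset k" "reg s\<^sub>0 ''W'' = Suc B"
    and cut: "cut_labels s\<^sub>0 I"
  shows "wp backtrack_loop s\<^sub>0 (\<lambda>t s. t \<le> (k + 1) * 100 \<and> cut_labels s {..<m} \<and>
    bich (\<lambda>v. arr s ''lab'' v \<noteq> 0) {..<m} \<le> B \<and> (\<Sum>v<n. w v (arr s ''lab'' v \<noteq> 0)) = X)"
  unfolding backtrack_loop_def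
proof (rule wp_While[where I = "\<lambda>s. \<exists>R I bs. elim (arr s\<^sub>0) (reg s ''k'') R I bs \<and>
      fits (arr s\<^sub>0 ''F'') R I bs (\<lambda>v. arr s ''lab'' v \<noteq> 0) (arr s ''bud'') X \<and>
      reg s ''off'' = offset (reg s ''k'') \<and> cut_labels s I"
      and \<mu> = "\<lambda>s. reg s ''k''" and K = 90], goal_cases)
  case 1
  show ?case using assms by blast
next
  case (2 s)
  have arrs: "arr s a = arr s\<^sub>0 a" if "a \<notin> {''bud'', ''lab'', ''cut''}" for a
    using 2(2) that by (simp add: frame_def written_backtrack_step)
  have W: "reg s ''W'' = Suc B"
    using 2(2) regs by (simp add: frame_def written_backtrack_step)
  obtain k' where k': "reg s ''k'' = Suc k'" using 2(3) gr0_implies_Suc by auto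
  obtain R I bs where inv: "elim (arr s\<^sub>0) (Suc k') R I bs"
    "fits (arr s\<^sub>0 ''F'') R I bs (\<lambda>v. arr s ''lab'' v \<noteq> 0) (arr s ''bud'') X"
    "reg s ''off'' = offset (Suc k')" "cut_labels s I"
    using 2(1) unfolding k' by blast
  from inv(1) show ?case
  proof cases
    case (elim_Suc R' I' bs' u p e)
    have "elim (arr s) k' R' I' bs'"
      by (rule elim_cong[OF elim_Suc(4)]) (simp_all add: arrs)
    then have "wp backtrack_step s (\<lambda>t s'. t \<le> 90 \<and> reg s' ''k'' = k' \<and> reg s' ''off'' = offset k' \<and>
      fits (arr s ''F'') R' I' bs' (\<lambda>v. arr s' ''lab'' v \<noteq> 0) (arr s' ''bud'') X \<and>
      (\<forall>i. arr s' ''cut'' i \<noteq> 0 \<longleftrightarrow> i \<in> I' \<and>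
        (arr s' ''lab'' (sr i) \<noteq> 0) \<noteq> (arr s' ''lab'' (ds i) \<noteq> 0)))"
    proof (rule wp_backtrack_step)
      show "arr s ''U'' k' = u" "arr s ''P'' k' = p" "arr s ''E'' k' = e"
        using elim_Suc by (simp_all add: arrs)
      show "merged (arr s ''F'') (arr s ''C'') (arr s ''D'') bs' u p (offset k')"
        using elim_Suc by (simp add: arrs)
      show "fits (arr s ''F'') (R' - {u}) (I' - {e}) (bs'(p := offset k'))
        (\<lambda>v. arr s ''lab'' v \<noteq> 0) (arr s ''bud'') X"
        using inv(2) unfolding elim_Suc(1-3) by (simp add: arrs)
      show "arr s ''cut'' i \<noteq> 0 \<longleftrightarrow> i \<in> I' - {e} \<and>
        (arr s ''lab'' (sr i) \<noteq> 0) \<noteq> (arr s ''lab'' (ds i) \<noteq> 0)" for i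
        using inv(4) unfolding elim_Suc(1-3) cut_labels_def by blast
    qed (use elim_Suc k' W inv(3) in blast)+
    then show ?thesis
    proof (rule wp_conseq, goal_cases)
      case (1 t s')
      have F: "arr s ''F'' = arr s\<^sub>0 ''F''" by (simp add: arrs)
      have k: "reg s' ''k'' = k'" using 1 by blast
      show ?case
        unfolding k using 1(1)[unfolded F] elim_Suc(4) k' unfolding cut_labels_def by auto
    qed
  qed
next
  case (3 t s)
  then obtain R I bs where inv: "elim (arr s\<^sub>0) 0 R I bs"
    "fits (arr s\<^sub>0 ''F'') R I bs (\<lambda>v. arr s ''lab'' v \<noteq> 0) (arr s ''bud'') X"
      "cut_labels s I" by auto
  from inv(1) show ?case
  proof cases
    case elim_0
    \<comment> \<open>Shares of at most \<open>B\<close> keep the look-ups inside the initial zero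
      rows, so only the vertex weights remain.\<close>
    have bud: "arr s ''bud'' v \<le> B" if "v < n" for v
      using member_le_sum[of v "{..<n}"
        "arr s ''bud''"] that inv(2) unfolding fits_def elim_0 by simp
    have "cost (arr s\<^sub>0 ''F'') (\<lambda>_. 0) v (arr s ''lab'' v \<noteq> 0)
      (arr s ''bud'' v) = w v (arr s ''lab'' v \<noteq> 0)"
      if "v < n" for v unfolding cost_def using elim_0(4) bud[OF that] by simp
    then have "(\<Sum>v<n. w v (arr s ''lab'' v \<noteq> 0)) = X"
      using inv(2) unfolding fits_def elim_0 by simp
    moreover have "bich (\<lambda>v. arr s ''lab'' v \<noteq> 0) {..<m} \<le> B"
      using inv(2) unfolding fits_def elim_0 by simp
    ultimately show ?thesis using inv(3) 3(4) regs unfolding elim_0 by simp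
  qed
qed

definition optimal :: "store \<Rightarrow> bool" where
  "optimal s \<longleftrightarrow> (\<exists>L.
    (\<forall>i<m. arr s ''cut'' i \<noteq> 0 \<longleftrightarrow> L (sr i) \<noteq> L (ds i)) \<and> bich L {..<m} \<le> B \<and>
    reg s ''saved'' = n - (\<Sum>v<n. w v (L v)) \<and>
    (\<forall>L'. bich L' {..<m} \<le> B \<longrightarrow> (\<Sum>v<n. w v (L v)) \<le> (\<Sum>v<n. w v (L' v))))"

text \<open>\<open>leaf\<close> guarantees that elimination stops only when no edge is left, and
  \<open>conn\<close> that a single vertex then remains.\<close>

lemma wp_main_prog:
  assumes prep: "prepared (set_reg ''W'' (Suc B) s\<^sub>0)"
    and regs: "\<And>x. x \<notin> {''n'', ''m'', ''B''} \<Longrightarrow> reg s\<^sub>0 x = 0"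
    and arrs: "\<And>a. a \<notin> {''src'', ''dst'', ''ign''} \<Longrightarrow> arr s\<^sub>0 a = (\<lambda>_. 0)"
    and size: "0 < n" "m \<le> n"
    and conn: "\<And>L :: nat \<Rightarrow> bool. \<forall>i<m. L (sr i) = L (ds i) \<Longrightarrow> \<forall>a<n. \<forall>b<n. L a = L b"
    and leaf: "\<And>I. I \<subseteq> {..<m} \<Longrightarrow> I \<noteq> {} \<Longrightarrow> \<exists>x<n. card (inc I x) = 1"
  shows "wp main_prog s\<^sub>0 (\<lambda>t s. t \<le> 2200 * (n * quad B) \<and> optimal s)"
proof -
  define s1 where "s1 = set_reg ''W'' (Suc B) s\<^sub>0"
  let ?fr = "\<lambda>s. \<forall>i. arr s ''lab'' i = 0 \<and> arr s ''cut'' i = 0"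
  have B: "reg s\<^sub>0 ''B'' = B" using prep unfolding prepared_def by simp
  have degree: "wp degree_loop s1 (\<lambda>t s. t \<le> (m + 1) * 100 \<and> reg s ''W'' = Suc B \<and>
    elim_state (set_reg ''off'' (Suc B + Suc B) s) {..<n} {..<m} \<and>
    reg s ''k'' = 0 \<and> reg s ''v'' = 0 \<and> reg s ''u'' = 0 \<and> ?fr s)"
  proof (rule wp_conseq, rule wp_degree_loop, goal_cases)
    case (5 t s)
    have wr: "written_regs degree_loop = {''z'', ''i''}"
      "written_arrs degree_loop = {''deg'', ''T''}"
      by (auto simp: degree_loop_def)
    have regs_s: "reg s x = reg s1 x" if "x \<notin> {''z'', ''i''}" for x
      using 5(2) that unfolding frame_def wr by blast
    have arrs_s: "arr s a = arr s1 a" if "a \<notin> {''deg'', ''T''}" for a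
      using 5(2) that unfolding frame_def wr by blast
    have "elim (arr s) 0 {..<n} {..<m} (\<lambda>_. 0)"
      by (rule elim_0) (simp add: arrs_s s1_def arrs)
    moreover have "prepared s"
      using prep unfolding prepared_def by (simp add: regs_s arrs_s s1_def)
    then have "prepared (set_reg ''off'' (Suc B + Suc B) s)"
      unfolding prepared_def by simp
    ultimately have "elim_state (set_reg ''off'' (Suc B + Suc B) s) {..<n} {..<m}"
      using 5(1) size unfolding elim_state_def by (simp add: regs_s arrs_s s1_def regs arrs)
    then show ?case
      using 5(1) by (simp add: regs_s arrs_s s1_def regs arrs)
  qed (use prep in \<open>simp_all add: s1_def regs arrs\<close>)
  have elim: "wp elim_loop s (\<lambda>t s. t \<le> (2 * n + 1) * (610 * quad B) \<and>
    elim_state s {reg s ''r''} {} \<and> ?fr s)"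
    if "elim_state s {..<n} {..<m}" "reg s ''k'' = 0" "reg s ''v'' = 0" "reg s ''u'' = 0"
      "?fr s" for s
  proof (rule wp_conseq, rule wp_elim_loop[OF that(1-4) size(1)], goal_cases)
    case (1 t s')
    then obtain R I where st: "elim_state s' R I" and no: "\<forall>x<n. card (inc I x) \<noteq> 1" by blast
    have el: "elim (arr s') (reg s' ''k'') R I (arr s' ''base'')" and r: "reg s' ''r'' \<in> R"
      using st unfolding elim_state_def by blast+
    have I: "I = {}" using leaf[OF elim_facts(2)[OF el]] no by blast
    \<comment> \<open>The labelling that singles out \<open>r\<close> is vacuously constant along
      the empty set of edges.\<close>
    have "a = reg s' ''r''" if "a \<in> R" for a
      using elim_connected[OF el conn, of "\<lambda>z. z = reg s' ''r''" a "reg s' ''r''"] I r that by simp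
    then have "R = {reg s' ''r''}" using r by blast
    moreover have "?fr s'" using 1(2) that(5) by (simp add: frame_def written_elim_loop)
    ultimately show ?case using st I 1(1) by blast
  qed
  have final: "wp finish_prog s (\<lambda>t s. t \<le> 60 \<and> wp backtrack_loop s (\<lambda>t s. t \<le> (n + 1) * 100 \<and>
    optimal s))"
    if st: "elim_state s {reg s ''r''} {}" and fr: "?fr s" for s
  proof (rule wp_conseq, rule wp_finish_prog[OF st], goal_cases)
    case 1
    show ?case using fr by auto
  next
    case (2 t s')
    then obtain X where X: "fits (arr s' ''F'') {reg s ''r''} {} (arr s' ''base'')
      (\<lambda>v. arr s' ''lab'' v \<noteq> 0) (arr s' ''bud'') X"
      "reg s' ''saved'' = n - X"
      "\<And>L \<beta> Y. fits (arr s' ''F'') {reg s ''r''} {} (arr s' ''base'') L \<beta> Y \<Longrightarrow> X \<le> Y" by blast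
    have wr: "written_regs finish_prog = {''x'', ''z'', ''a'', ''b'', ''saved''}"
      "written_arrs finish_prog = {''bud'', ''lab''}"
      by (auto simp: finish_prog_def load_weight_def)
    have regs': "reg s' x = reg s x" if "x \<notin> {''x'', ''z'', ''a'', ''b'', ''saved''}" for x
      using 2(2) that unfolding frame_def wr by blast
    have arrs': "arr s' a = arr s a" if "a \<notin> {''bud'', ''lab''}" for a
      using 2(2) that unfolding frame_def wr by blast
    let ?k = "reg s ''k''"
    have el: "elim (arr s) ?k {reg s ''r''} {} (arr s ''base'')"
      using st unfolding elim_state_def by blast
    then have el': "elim (arr s') ?k {reg s ''r''} {} (arr s' ''base'')"
      by (simp add: arrs') (erule elim_cong, simp_all add: arrs')
    have "?k \<le> n" using elim_facts(3)[OF el] by simp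
    have "wp backtrack_loop s' (\<lambda>t s. t \<le> (?k + 1) * 100 \<and> cut_labels s {..<m} \<and>
      bich (\<lambda>v. arr s ''lab'' v \<noteq> 0) {..<m} \<le> B \<and> (\<Sum>v<n. w v (arr s ''lab'' v \<noteq> 0)) = X)"
      using st fr by (intro wp_backtrack_loop[OF el' X(1)])
        (simp_all add: regs' arrs' elim_state_def prepared_def cut_labels_def)
    then have "wp backtrack_loop s' (\<lambda>t s. t \<le> (n + 1) * 100 \<and> optimal s)"
    proof (rule wp_conseq, goal_cases)
      case (1 t' s3)
      have "reg s3 ''saved'' = n - X"
        using 1(2) X(2) by (simp add: frame_def backtrack_loop_def written_backtrack_step)
      moreover have "X \<le> (\<Sum>v<n. w v (L' v))" if "bich L' {..<m} \<le> B" for L'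
        using elim_lower_bound[OF el' that size(1)] X(3) le_trans by blast
      moreover have "t' \<le> (n + 1) * 100" using 1(1) \<open>?k \<le> n\<close> by simp
      ultimately show ?case
        using 1(1) unfolding cut_labels_def optimal_def
        by (intro conjI exI[of _ "\<lambda>v. arr s3 ''lab'' v \<noteq> 0"]) auto
    qed
    then show ?case using 2(1) by blast
  qed
  \<comment> \<open>The main share is \<open>3 * 610 = 1830\<close>; the terms linear in
    \<open>n\<close> and the constants fit into the rest because \<open>quad B\<close> is at least 4
    and \<open>n\<close> is positive.\<close>
  have time: "t1 + (t2 + (t3 + t4)) + 30 \<le> 2200 * (n * quad B)"
    if "t1 \<le> (m + 1) * 100" "t2 \<le> (2 * n + 1) * (610 * quad B)" "t3 \<le> 60"
      "t4 \<le> (n + 1) * 100" for t1 t2 t3 t4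
  proof -
    have "(2 * n + 1) * (610 * quad B) \<le> (3 * n) * (610 * quad B)" using size
      by (intro mult_right_mono) auto
    also have "\<dots> = 1830 * (n * quad B)" by simp
    finally have "t2 \<le> 1830 * (n * quad B)" by (rule le_trans[OF that(2)])
    moreover have "n * 4 \<le> n * quad B" using quad_ge[of B] by (rule mult_left_mono) simp
    moreover have "t1 \<le> m * 100 + 100" "t4 \<le> n * 100 + 100" using that(1,4) by auto
    ultimately show ?thesis using that(3) size by linarith
  qed
  show ?thesis
    unfolding main_prog_def wp_Seq[of "Assign _ _"] wp_Seq[of degree_loop] wp_Seq[of elim_loop]
      wp_Seq[of finish_prog] wp_Assign
    apply (simp add: B)
    apply (rule wp_conseq[OF degree[unfolded s1_def]], elim conjE)
    subgoal for t1 s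
      apply (rule wp_conseq[OF elim], simp_all)
      apply (elim conjE, rule wp_conseq[OF final], simp_all)
      apply (elim conjE, erule wp_conseq)
      using time by fastforce
    done
qed

end

section \<open>Cuts and labellings\<close>

lemma reachable_mono_label:
  fixes L :: "'a \<Rightarrow> bool"
  assumes "reachable E u v" "\<And>a b. {a, b} \<in> E \<Longrightarrow> L a = L b"
  shows "L u = L v"
  using assms(1) unfolding reachable_def
  by (induction rule: rtrancl_induct) (auto simp: adjacency_def dest: assms(2))

lemma reachable_refl: "reachable E x x"
  by (simp add: reachable_def)

lemma reachable_sym: "reachable E u v \<Longrightarrow> reachable E v u"
proof -
  have "sym (adjacency E)" by (auto simp: sym_def adjacency_def insert_commute)
  then show "reachable E u v \<Longrightarrow> reachable E v u"
    unfolding reachable_def by (metis sym_rtrancl symD)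
qed

lemma reachable_step: "reachable E u v \<Longrightarrow> {v, x} \<in> E \<Longrightarrow> reachable E u x"
  unfolding reachable_def adjacency_def by (auto intro: rtrancl_into_rtrancl)

text \<open>With ignition probabilities 0 and 1, the product over the component of \<open>x\<close>
  is the indicator of \<open>x\<close> being saved. Symmetry of reachability reconciles the
  component, explored from \<open>x\<close>, with \<open>saved\<close>, explored from
  \<open>V'\<close>.\<close>

lemma risk_eq:
  assumes "V' \<subseteq> V" "finite V" "\<forall>v\<in>V'. \<pi>\<^sub>i v = 1" "\<forall>v\<in>V - V'. \<pi>\<^sub>i v = 0"
  shows "risk V E (\<lambda>_. 1) \<pi>\<^sub>i H = real (card V) - real (card (saved V E V' H))"
proof -
  have "(\<Prod>t\<in>component V (E - H) x. 1 - \<pi>\<^sub>i t) = of_bool (x \<in> saved V E V' H)" if "x \<in> V" for x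
  proof (cases "x \<in> saved V E V' H")
    case True
    have "\<pi>\<^sub>i t = 0" if "t \<in> component V (E - H) x" for t
    proof -
      have "t \<in> V" "reachable (E - H) t x" using that reachable_sym unfolding component_def by auto
      then show ?thesis using True assms(4) unfolding saved_def by blast
    qed
    then show ?thesis using True by simp
  next
    case False
    then obtain v where "v \<in> V'" "reachable (E - H) v x"
      using \<open>x \<in> V\<close> unfolding saved_def by blast
    then have "v \<in> V'" "reachable (E - H) x v" using reachable_sym[of "E - H" v x] by simp_all
    then have "v \<in> component V (E - H) x" "1 - \<pi>\<^sub>i v = 0"
      using assms unfolding component_def by auto
    moreover have "finite (component V (E - H) x)" using assms(2) unfolding component_def by simp
    ultimately show ?thesis using False prod_zero by fastforce
  qed
  then have "risk V E (\<lambda>_. 1) \<pi>\<^sub>i H = (\<Sum>x\<in>V. 1 - of_bool (x \<in> saved V E V' H))"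
    unfolding risk_def by (intro sum.cong) auto
  also have "\<dots> = real (card V) - (\<Sum>x\<in>V. of_bool (x \<in> saved V E V' H))"
    by (simp add: sum_subtractf)
  also have "(\<Sum>x\<in>V. of_bool (x \<in> saved V E V' H)) = real (card (saved V E V' H))"
  proof -
    have "V \<inter> {x. x \<in> saved V E V' H} = saved V E V' H" unfolding saved_def by auto
    then show ?thesis using assms(2) by simp
  qed
  finally show ?thesis .
qed

section \<open>From trees and cut systems to indexed labellings\<close>

locale fire_tree =
  fixes n :: nat and E :: "nat set set" and es :: "(nat \<times> nat) list" and V' :: "nat set"
    and B :: nat
  assumes tree: "is_tree {..<n} E" and edges: "lists_edges es E" and ign: "V' \<subseteq> {..<n}"
begin

text \<open>Letting everything burn costs \<open>n\<close> and cuts nothing, so \<open>Suc n\<close>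
  is large enough to keep vertices of \<open>V'\<close> from being coloured \<open>False\<close> in
  an optimum.\<close>

definition weight :: "nat \<Rightarrow> bool \<Rightarrow> nat" where
  "weight v c = (if c then 1 else if v \<in> V' then Suc n else 0)"

abbreviation edge :: "nat \<Rightarrow> nat set" where
  "edge i \<equiv> uedge (es ! i)"

lemma edge_inj: "i < length es \<Longrightarrow> j < length es \<Longrightarrow> edge i = edge j \<Longrightarrow> i = j"
  using edges unfolding lists_edges_def by (metis length_map nth_eq_iff_index_eq nth_map)

lemma edge_in: "i < length es \<Longrightarrow> edge i \<in> E"
  using edges unfolding lists_edges_def by force

lemma edge_ex: "e \<in> E \<Longrightarrow> \<exists>i<length es. e = edge i"
  using edges unfolding lists_edges_def by (metis in_set_conv_nth length_map nth_map)

lemma edge_graph: "\<forall>e\<in>E. e \<subseteq> {..<n} \<and> card e = 2" and acyclic: "\<nexists>p. is_cycle E p"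
  using tree unfolding is_tree_def simple_graph_def by auto

sublocale cut_dp n "length es" B "\<lambda>i. fst (es ! i)" "\<lambda>i. snd (es ! i)" weight
proof
  fix i assume "i < length es"
  then have "edge i \<subseteq> {..<n}" "card (edge i) = 2" using edge_in edge_graph by auto
  then show "fst (es ! i) < n \<and> snd (es ! i) < n \<and> fst (es ! i) \<noteq> snd (es ! i)"
    unfolding uedge_def by (auto simp: card_insert_if split: if_splits)
qed

lemma edge_label:
  assumes "{a, b} = edge i"
  shows "L a = L b \<longleftrightarrow> L (fst (es ! i)) = L (snd (es ! i))"
  using assms unfolding uedge_def by (auto simp: doubleton_eq_iff)

lemma connected_labels:
  fixes L :: "nat \<Rightarrow> bool"
  assumes "\<forall>i<length es. L (fst (es ! i)) = L (snd (es ! i))"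
  shows "\<forall>a<n. \<forall>b<n. L a = L b"
proof (intro allI impI)
  fix a b assume "a < n" "b < n"
  then have "reachable E a b" using tree unfolding is_tree_def connected_graph_def by blast
  then show "L a = L b"
  proof (rule reachable_mono_label)
    fix x y assume "{x, y} \<in> E"
    then obtain i where "i < length es" "{x, y} = edge i" using edge_ex by blast
    then show "L x = L y" using assms edge_label[of x y i L] by simp
  qed
qed

text \<open>A subset of the edges is still acyclic and so has a leaf; as the edges are listed
  without repetition, exactly one index belongs to the leaf's edge.\<close>

lemma leaf_exists:
  assumes "I \<subseteq> {..<length es}" "I \<noteq> {}"
  shows "\<exists>x<n. card (inc I x) = 1"
proof -
  have sub: "edge ` I \<subseteq> E" using assms edge_in by auto
  have "\<exists>x e. {f \<in> edge ` I. x \<in> f} = {e}"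
  proof (rule acyclic_leaf)
    show "\<forall>e\<in>edge ` I. e \<subseteq> {..<n} \<and> card e = 2" using sub edge_graph by blast
    show "\<nexists>p. is_cycle (edge ` I) p" using acyclic_mono[OF acyclic sub] .
  qed (use assms in auto)
  then obtain x e where xe: "{f \<in> edge ` I. x \<in> f} = {e}" by blast
  then have "e \<in> {f \<in> edge ` I. x \<in> f}" by simp
  then obtain i where i: "i \<in> I" "x \<in> edge i" "e = edge i" by auto
  have only: "j = i" if "j \<in> I" "x \<in> edge j" for j
  proof -
    have "edge j \<in> {f \<in> edge ` I. x \<in> f}" using that by simp
    then have "edge j = edge i" unfolding xe i(3) by simp
    then show ?thesis using edge_inj that i assms(1) by auto
  qed
  have "inc I x = {j \<in> I. x \<in> edge j}" unfolding inc_def uedge_def by auto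
  also have "\<dots> = {i}" using i(1,2) only by blast
  finally have "inc I x = {i}" .
  moreover have "x < n"
  proof -
    have "edge i \<subseteq> {..<n}" using i(1) sub edge_graph by auto
    then show ?thesis using i(2) by auto
  qed
  ultimately show ?thesis by auto
qed

lemma size_bounds: "0 < n" "length es \<le> n"
proof -
  show "0 < n" using tree unfolding is_tree_def connected_graph_def by auto
  have "card E = length es"
    using edges unfolding lists_edges_def by (metis distinct_card length_map)
  then show "length es \<le> n" using acyclic_card_edges[OF _ edge_graph acyclic] by simp
qed

lemma finite_E: "finite E"
  using edges unfolding lists_edges_def by (metis List.finite_set)

text \<open>The ends of an uncut edge are reachable from the same vertices, so the status of being
  saved changes only across edges of \<open>H\<close>.\<close>

lemma bich_saved:
  assumes "H \<subseteq> E" "card H \<le> B"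
  shows "bich (\<lambda>v. v \<notin> saved {..<n} E V' H) {..<length es} \<le> B"
proof -
  let ?L = "\<lambda>v. v \<notin> saved {..<n} E V' H"
  let ?J = "{i \<in> {..<length es}. ?L (fst (es ! i)) \<noteq> ?L (snd (es ! i))}"
  have "edge i \<in> H" if "i \<in> ?J" for i
  proof (rule ccontr)
    assume "edge i \<notin> H"
    then have "{fst (es ! i), snd (es ! i)} \<in> E - H" "{snd (es ! i), fst (es ! i)} \<in> E - H"
      using that edge_in[of i] unfolding uedge_def by (auto simp: insert_commute)
    then have "reachable (E - H) v (fst (es ! i)) \<longleftrightarrow> reachable (E - H) v (snd (es ! i))" for v
      using reachable_step[of "E - H" v] by metis
    moreover have "fst (es ! i) < n" "snd (es ! i) < n" using that ends by auto
    ultimately have "?L (fst (es ! i)) = ?L (snd (es ! i))" unfolding saved_def by simp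
    then show False using that by blast
  qed
  then have "edge ` ?J \<subseteq> H" by blast
  moreover have "inj_on edge ?J" by (rule inj_onI, rule edge_inj) auto
  ultimately have "card ?J \<le> card H"
    using finite_subset[OF assms(1) finite_E] by (intro card_inj_on_le)
  then show ?thesis using assms(2) unfolding bich_def by simp
qed

lemma sum_weight:
  assumes "\<And>v. v \<in> V' \<Longrightarrow> L v"
  shows "(\<Sum>v<n. weight v (L v)) = n - card {v. v < n \<and> \<not> L v}"
proof -
  have "(\<Sum>v<n. weight v (L v)) = (\<Sum>v<n. of_bool (L v))"
    using assms by (intro sum.cong) (auto simp: weight_def)
  also have "\<dots> = card ({..<n} - {v. v < n \<and> \<not> L v})"
    by (simp, intro arg_cong[where f = card]) auto
  also have "\<dots> = n - card {v. v < n \<and> \<not> L v}"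
    by (subst card_Diff_subset) auto
  finally show ?thesis .
qed

text \<open>Every vertex coloured \<open>False\<close> is saved by \<open>H\<close>, but
  \<open>H\<close> could a priori save more than the colouring claims. The upper bound
  \<open>card_le\<close>, valid for all admissible cuts, applied to \<open>H\<close> itself rules
  this out.\<close>

lemma optimal_labels:
  assumes opt: "\<And>L'. bich L' {..<length es} \<le> B \<Longrightarrow> (\<Sum>v<n. weight v (L v)) \<le> (\<Sum>v<n. weight v (L' v))"
    and bich: "bich L {..<length es} \<le> B"
    and H: "H = {edge i | i. i < length es \<and> L (fst (es ! i)) \<noteq> L (snd (es ! i))}"
  shows "H \<subseteq> E" "card H \<le> B" "n - (\<Sum>v<n. weight v (L v)) = card (saved {..<n} E V' H)"
    "\<And>H'. H' \<subseteq> E \<Longrightarrow> card H' \<le> B \<Longrightarrow> card (saved {..<n} E V' H') \<le> card (saved {..<n} E V' H)"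
proof -
  have H_img: "H = edge ` {i \<in> {..<length es}. L (fst (es ! i)) \<noteq> L (snd (es ! i))}"
    unfolding H by auto
  show "H \<subseteq> E" unfolding H using edge_in by auto
  have "card H \<le> bich L {..<length es}" unfolding H_img bich_def by (intro card_image_le) auto
  then show "card H \<le> B" using bich by simp
  \<comment> \<open>Comparison with the all-burning colouring, which has no bichromatic
    edge.\<close>
  have "(\<Sum>v<n. weight v (L v)) \<le> n"
    using opt[of "\<lambda>_. True"] by (simp add: bich_def weight_def)
  moreover have "weight v (L v) \<le> (\<Sum>v<n. weight v (L v))" if "v < n" for v
    using that by (intro member_le_sum) auto
  ultimately have small: "weight v (L v) \<le> n" if "v < n" for v using that by (meson le_trans)
  have burn: "L v" if "v \<in> V'" for v
    using small[of v] that ign unfolding weight_def by (auto split: if_splits)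
  have card_le: "card (saved {..<n} E V' H') \<le> n - (\<Sum>v<n. weight v (L v))" if "H' \<subseteq> E"
    "card H' \<le> B" for H'
  proof -
    let ?L = "\<lambda>v. v \<notin> saved {..<n} E V' H'"
    have "(\<Sum>v<n. weight v (?L v)) = n - card {v. v < n \<and> \<not> ?L v}"
      by (intro sum_weight) (auto simp: saved_def intro: reachable_refl)
    moreover have "{v. v < n \<and> \<not> ?L v} = saved {..<n} E V' H'" unfolding saved_def by auto
    moreover have "card (saved {..<n} E V' H') \<le> card {..<n}"
      by (intro card_mono) (auto simp: saved_def)
    ultimately show ?thesis using opt[OF bich_saved[OF that]] by simp
  qed
  have "{v. v < n \<and> \<not> L v} \<subseteq> saved {..<n} E V' H"
  proof
    fix x assume x: "x \<in> {v. v < n \<and> \<not> L v}"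
    have "\<not> reachable (E - H) v x" if "v \<in> V'" for v
    proof
      assume "reachable (E - H) v x"
      then have "L v = L x"
      proof (rule reachable_mono_label)
        fix a b assume ab: "{a, b} \<in> E - H"
        then obtain i where "i < length es" "{a, b} = edge i" using edge_ex by blast
        then show "L a = L b" using ab edge_label[of a b i L] unfolding H by auto
      qed
      then show False using burn[OF that] x by blast
    qed
    then show "x \<in> saved {..<n} E V' H" using x unfolding saved_def by auto
  qed
  then have "card {v. v < n \<and> \<not> L v} \<le> card (saved {..<n} E V' H)"
    by (intro card_mono) (auto simp: saved_def)
  moreover have "card {v. v < n \<and> \<not> L v} \<le> card {..<n}" by (intro card_mono) auto
  ultimately show eq: "n - (\<Sum>v<n. weight v (L v)) = card (saved {..<n} E V' H)"
    using sum_weight[OF burn] card_le[OF \<open>H \<subseteq> E\<close> \<open>card H \<le> B\<close>] by auto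
  show "card (saved {..<n} E V' H') \<le> card (saved {..<n} E V' H)" if "H' \<subseteq> E" "card H' \<le> B" for H'
    using card_le[OF that] unfolding eq .
qed

lemma main_prog_correct:
  "wp main_prog (input_store n es V' B) (\<lambda>t s. t \<le> 2200 * (n * quad B) \<and>
     output_cut es s \<subseteq> E \<and> card (output_cut es s) \<le> B \<and>
     output_saved s = card (saved {..<n} E V' (output_cut es s)) \<and>
     (\<forall>H'\<subseteq>E. card H' \<le> B \<longrightarrow> card (saved {..<n} E V' H') \<le> card (saved {..<n} E V'
       (output_cut es s))))"
proof (rule wp_conseq, rule wp_main_prog, goal_cases)
  case 1
  show ?case unfolding prepared_def by (simp add: input_store_def weight_def)
next
  case (8 t s)
  then obtain L where L: "\<forall>i<length es. arr s ''cut'' i \<noteq> 0 \<longleftrightarrow> L (fst (es ! i)) \<noteq> L (snd (es ! i))"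
    "bich L {..<length es} \<le> B" "reg s ''saved'' = n - (\<Sum>v<n. weight v (L v))"
    "\<And>L'. bich L' {..<length es} \<le> B \<Longrightarrow> (\<Sum>v<n. weight v (L v)) \<le> (\<Sum>v<n. weight v (L' v))"
    unfolding optimal_def by blast
  have H: "output_cut es s = {edge i | i. i < length es \<and> L (fst (es ! i)) \<noteq> L (snd (es ! i))}"
    using L(1) unfolding output_cut_def by blast
  show ?case
    using optimal_labels[OF L(4) L(2) H] 8(1) L(3) unfolding output_saved_def by auto
qed (use size_bounds connected_labels leaf_exists in \<open>auto simp: input_store_def\<close>)

end

text \<open>The reason is \<open>B + 2 \<le> 3 * max 1 B\<close>. The maximum matters at
  \<open>B = 0\<close>, where \<open>n * B\<^sup>2\<close> vanishes although the program still takes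
  steps.\<close>

lemma quad_le: "quad B \<le> 9 * (max 1 B)\<^sup>2"
proof -
  have "quad B \<le> (3 * max 1 B) * (3 * max 1 B)" unfolding quad_def by (intro mult_le_mono) auto
  then show ?thesis by (simp add: power2_eq_square)
qed

theorem theorem2:
  "\<exists>(P :: com) (C :: nat). \<forall>(n :: nat) (E :: nat set set) (es :: (nat \<times> nat) list)
      (V' :: nat set) (B :: nat) (\<pi>\<^sub>i :: nat \<Rightarrow> real).
    is_tree {..<n} E \<longrightarrow> lists_edges es E \<longrightarrow> V' \<subseteq> {..<n} \<longrightarrow>
    (\<forall>v\<in>V'. \<pi>\<^sub>i v = 1) \<longrightarrow> (\<forall>v\<in>{..<n} - V'. \<pi>\<^sub>i v = 0) \<longrightarrow>
    (\<exists>t s. exec P (input_store n es V' B) t s \<and>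
      t \<le> C * (n * (max 1 B)\<^sup>2) \<and>
      output_cut es s \<subseteq> E \<and> card (output_cut es s) \<le> B \<and>
      optimal_cut {..<n} E (\<lambda>_. 1) (\<lambda>_. 1) \<pi>\<^sub>i (real B) (output_cut es s) \<and>
      output_saved s = card (saved {..<n} E V' (output_cut es s)) \<and>
      (\<forall>H \<subseteq> E. card H \<le> B \<longrightarrow> card (saved {..<n} E V' H) \<le> output_saved s))"
proof (rule exI[of _ main_prog], rule exI[of _ 19800], intro allI impI)
  fix n E es V' B and \<pi>\<^sub>i :: "nat \<Rightarrow> real"
  assume "is_tree {..<n} E" "lists_edges es E" and ign: "V' \<subseteq> {..<n}"
    and prob: "\<forall>v\<in>V'. \<pi>\<^sub>i v = 1" "\<forall>v\<in>{..<n} - V'. \<pi>\<^sub>i v = 0"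
  then interpret fire_tree n E es V' B by unfold_locales
  from main_prog_correct obtain t s where run: "exec main_prog (input_store n es V' B) t s"
    and time: "t \<le> 2200 * (n * quad B)" and cut: "output_cut es s \<subseteq> E" "card (output_cut es s) \<le> B"
    and sav: "output_saved s = card (saved {..<n} E V' (output_cut es s))"
    and max: "\<forall>H\<subseteq>E. card H \<le> B \<longrightarrow> card (saved {..<n} E V' H) \<le> card (saved {..<n} E V'
      (output_cut es s))"
    unfolding wp_def by blast
  have "n * quad B \<le> n * (9 * (max 1 B)\<^sup>2)" by (rule mult_le_mono2[OF quad_le])
  \<comment> \<open>The constant is \<open>2200 * 9\<close>.\<close>
  then have "t \<le> 19800 * (n * (max 1 B)\<^sup>2)" using time by linarith
  moreover have "optimal_cut {..<n} E (\<lambda>_. 1) (\<lambda>_. 1) \<pi>\<^sub>i (real B) (output_cut es s)"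
    unfolding optimal_cut_def feasible_cut_def cut_cost_def
      risk_eq[OF ign finite_lessThan prob]
    using cut max by simp
  ultimately show "\<exists>t s. exec main_prog (input_store n es V' B) t s \<and>
      t \<le> 19800 * (n * (max 1 B)\<^sup>2) \<and>
      output_cut es s \<subseteq> E \<and> card (output_cut es s) \<le> B \<and>
      optimal_cut {..<n} E (\<lambda>_. 1) (\<lambda>_. 1) \<pi>\<^sub>i (real B) (output_cut es s) \<and>
      output_saved s = card (saved {..<n} E V' (output_cut es s)) \<and>
      (\<forall>H \<subseteq> E. card H \<le> B \<longrightarrow> card (saved {..<n} E V' H) \<le> output_saved s)"
    using run cut sav max by (intro exI[of _ t] exI[of _ s] conjI) simp_all
qed

end
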